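(* Let $G$ be a finitely generated acylindrically hyperbolic group. Then the subgroup $\ker\left(G \curvearrowright \mathrm{Cone}_{\omega}(G,d_n)\right)$ of $G$ does not depend on the choice of the non-principal ultrafilter $\omega$ on $\mathbb{N}$ and of the unbounded non-decreasing sequence $(d_n)$ of positive reals.
   Context: Asymptotic cones. Let $G$ be a finitely generated group with finite generating set $S$ and word length $\|\cdot\|_S$, $\omega$ a non-principal ultrafilter on $\mathbb{N}$, and $(d_n)$ an unbounded non-decreasing sequence of positive reals. $\mathrm{Cone}_\omega(G,d_n)$ is the ultralimit of $(\Gamma(G,S), \frac{1}{d_n}d_S, e)$; its points are represented by sequences $\{x_n\}$ in $G$ with $\|x_n\|_S/d_n$ bounded (admissible sequences), where $\{x_n\}=\{y_n\}$ iff $\lim_\omega \|x_n^{-1}y_n\|_S/d_n=0$. $G$ acts isometrically by $g\cdot\{x_n\}=\{gx_n\}$. The kernel is the set of $g \in G$ with $\lim_\omega \|x_n^{-1}gx_n\|_S/d_n=0$ for all admissible $\{x_n\}$. Acylindrical hyperbolicity. A $\delta$-hyperbolic space is a geodesic metric space with uniformly thin geodesic triangles. An isometric action of $G$ on a metric space $X$ is acylindrical if for every $\epsilon>0$ there are $R,N>0$ such that $|\{g\in G: d(x,gx)\le\epsilon, d(y,gy)\le\epsilon\}|\le N$ whenever $d(x,y)\ge R$. An action on a $\delta$-hyperbolic space $X$ is non-elementary if the limit set of $G$ in the Gromov boundary $\partial X$ has more than 2 points. $G$ is acylindrically hyperbolic if it admits a non-elementary acylindrical isometric action on some $\delta$-hyperbolic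 space. *)

theory Defs
  imports "HOL-Analysis.Analysis" "HOL-Algebra.Generated_Groups" "HOL-Algebra.Group_Action"
begin

section \<open>Word length\<close>

definition word_length :: "('a, 'b) monoid_scheme \<Rightarrow> 'a set \<Rightarrow> 'a \<Rightarrow> nat" where
  "word_length G S g =
     (LEAST n. \<exists>ws. length ws = n \<and> set ws \<subseteq> S \<union> m_inv G ` S \<and> foldr (mult G) ws (one G) = g)"

definition word_dist :: "('a, 'b) monoid_scheme \<Rightarrow> 'a set \<Rightarrow> 'a \<Rightarrow> 'a \<Rightarrow> real" where
  "word_dist G S x y = real (word_length G S (m_inv G x \<otimes>\<^bsub>G\<^esub> y))"


section \<open>Asymptotic cones\<close>

text \<open>An ultrafilter on the naturals is given as a filter \<open>\<omega>\<close>, so that \<open>(f \<longlongrightarrow> l) \<omega>\<close>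
  is the limit along \<open>\<omega>\<close>.\<close>

definition nonprincipal_ultrafilter :: "nat filter \<Rightarrow> bool" where
  "nonprincipal_ultrafilter \<omega> \<longleftrightarrow>
     \<omega> \<noteq> bot \<and>
     (\<forall>A. eventually (\<lambda>n. n \<in> A) \<omega> \<or> eventually (\<lambda>n. n \<notin> A) \<omega>) \<and>
     (\<forall>k. \<not> eventually (\<lambda>n. n = k) \<omega>)"

definition scaling_sequence :: "(nat \<Rightarrow> real) \<Rightarrow> bool" where
  "scaling_sequence d \<longleftrightarrow> (\<forall>n. 0 < d n) \<and> incseq d \<and> \<not> bdd_above (range d)"

definition admissible :: "('a, 'b) monoid_scheme \<Rightarrow> 'a set \<Rightarrow> (nat \<Rightarrow> real) \<Rightarrow> (nat \<Rightarrow> 'a) set" where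
  "admissible G S d =
     {x. (\<forall>n. x n \<in> carrier G) \<and> (\<exists>C. \<forall>n. real (word_length G S (x n)) / d n \<le> C)}"

definition cone_rel ::
  "('a, 'b) monoid_scheme \<Rightarrow> 'a set \<Rightarrow> nat filter \<Rightarrow> (nat \<Rightarrow> real) \<Rightarrow> ((nat \<Rightarrow> 'a) \<times> (nat \<Rightarrow> 'a)) set"
  where
  "cone_rel G S \<omega> d =
     {(x, y). x \<in> admissible G S d \<and> y \<in> admissible G S d \<and>
              ((\<lambda>n. word_dist G S (x n) (y n) / d n) \<longlongrightarrow> 0) \<omega>}"

text \<open>The set of points of the cone. Every point of the ultralimit of the rescaled Cayley graphs is
  represented by a sequence of vertices, so sequences in \<open>G\<close> suffice.\<close>

definition asymptotic_cone ::
  "('a, 'b) monoid_scheme \<Rightarrow> 'a set \<Rightarrow> nat filter \<Rightarrow> (nat \<Rightarrow> real) \<Rightarrow> (nat \<Rightarrow> 'a) set set" where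
  "asymptotic_cone G S \<omega> d = admissible G S d // cone_rel G S \<omega> d"

definition cone_action ::
  "('a, 'b) monoid_scheme \<Rightarrow> 'a set \<Rightarrow> nat filter \<Rightarrow> (nat \<Rightarrow> real) \<Rightarrow>
   'a \<Rightarrow> (nat \<Rightarrow> 'a) set \<Rightarrow> (nat \<Rightarrow> 'a) set" where
  "cone_action G S \<omega> d g =
     (\<lambda>p \<in> asymptotic_cone G S \<omega> d. \<Union>x\<in>p. cone_rel G S \<omega> d `` {\<lambda>n. g \<otimes>\<^bsub>G\<^esub> x n})"

definition cone_kernel ::
  "('a, 'b) monoid_scheme \<Rightarrow> 'a set \<Rightarrow> nat filter \<Rightarrow> (nat \<Rightarrow> real) \<Rightarrow> 'a set" where
  "cone_kernel G S \<omega> d = kernel G (BijGroup (asymptotic_cone G S \<omega> d)) (cone_action G S \<omega> d)"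


section \<open>Hyperbolic spaces\<close>

definition geodesic_segment :: "'x metric \<Rightarrow> 'x \<Rightarrow> 'x \<Rightarrow> 'x set \<Rightarrow> bool" where
  "geodesic_segment X x y P \<longleftrightarrow>
     (\<exists>\<gamma> :: real \<Rightarrow> 'x. \<gamma> 0 = x \<and> \<gamma> (mdist X x y) = y \<and> P = \<gamma> ` {0..mdist X x y} \<and> P \<subseteq> mspace X \<and>
        (\<forall>s\<in>{0..mdist X x y}. \<forall>t\<in>{0..mdist X x y}. mdist X (\<gamma> s) (\<gamma> t) = \<bar>s - t\<bar>))"

definition geodesic_space :: "'x metric \<Rightarrow> bool" where
  "geodesic_space X \<longleftrightarrow> (\<forall>x\<in>mspace X. \<forall>y\<in>mspace X. \<exists>P. geodesic_segment X x y P)"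

definition thin_triangles :: "'x metric \<Rightarrow> real \<Rightarrow> bool" where
  "thin_triangles X \<delta> \<longleftrightarrow>
     (\<forall>x\<in>mspace X. \<forall>y\<in>mspace X. \<forall>z\<in>mspace X. \<forall>P Q R.
        geodesic_segment X x y P \<longrightarrow> geodesic_segment X y z Q \<longrightarrow> geodesic_segment X z x R \<longrightarrow>
        (\<forall>p\<in>P. \<exists>q\<in>Q \<union> R. mdist X p q \<le> \<delta>))"

definition hyperbolic_space :: "'x metric \<Rightarrow> bool" where
  "hyperbolic_space X \<longleftrightarrow> geodesic_space X \<and> (\<exists>\<delta>\<ge>0. thin_triangles X \<delta>)"


section \<open>Gromov boundary and limit sets\<close>

definition gromov_product :: "'x metric \<Rightarrow> 'x \<Rightarrow> 'x \<Rightarrow> 'x \<Rightarrow> real" where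
  "gromov_product X p x y = (mdist X x p + mdist X y p - mdist X x y) / 2"

text \<open>Gromov products at two base points differ by a bounded amount, so in the two definitions
  below quantifying over all base points is the same as fixing one.\<close>

definition converges_to_infinity :: "'x metric \<Rightarrow> (nat \<Rightarrow> 'x) \<Rightarrow> bool" where
  "converges_to_infinity X x \<longleftrightarrow> range x \<subseteq> mspace X \<and>
     (\<forall>p\<in>mspace X. \<forall>K. \<exists>N. \<forall>i\<ge>N. \<forall>j\<ge>N. K \<le> gromov_product X p (x i) (x j))"

definition boundary_rel :: "'x metric \<Rightarrow> ((nat \<Rightarrow> 'x) \<times> (nat \<Rightarrow> 'x)) set" where
  "boundary_rel X =
     {(x, y). converges_to_infinity X x \<and> converges_to_infinity X y \<and>
        (\<forall>p\<in>mspace X. \<forall>K. \<exists>N. \<forall>i\<ge>N. \<forall>j\<ge>N. K \<le> gromov_product X p (x i) (y j))}"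

definition gromov_boundary :: "'x metric \<Rightarrow> (nat \<Rightarrow> 'x) set set" where
  "gromov_boundary X = {x. converges_to_infinity X x} // boundary_rel X"

text \<open>A sequence in \<open>X\<close> converges to a boundary point iff it belongs to that equivalence class, so
  this is the set of accumulation points in the boundary of the orbits.\<close>

definition limit_set ::
  "('a, 'b) monoid_scheme \<Rightarrow> 'x metric \<Rightarrow> ('a \<Rightarrow> 'x \<Rightarrow> 'x) \<Rightarrow> (nat \<Rightarrow> 'x) set set" where
  "limit_set G X \<phi> =
     {\<xi> \<in> gromov_boundary X. \<exists>p\<in>mspace X. \<exists>g :: nat \<Rightarrow> 'a. range g \<subseteq> carrier G \<and> (\<lambda>n. \<phi> (g n) p) \<in> \<xi>}"


section \<open>Acylindrically hyperbolic groups\<close>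

definition isometric_action ::
  "('a, 'b) monoid_scheme \<Rightarrow> 'x metric \<Rightarrow> ('a \<Rightarrow> 'x \<Rightarrow> 'x) \<Rightarrow> bool" where
  "isometric_action G X \<phi> \<longleftrightarrow> group_action G (mspace X) \<phi> \<and>
     (\<forall>g\<in>carrier G. \<forall>x\<in>mspace X. \<forall>y\<in>mspace X. mdist X (\<phi> g x) (\<phi> g y) = mdist X x y)"

definition acylindrical ::
  "('a, 'b) monoid_scheme \<Rightarrow> 'x metric \<Rightarrow> ('a \<Rightarrow> 'x \<Rightarrow> 'x) \<Rightarrow> bool" where
  "acylindrical G X \<phi> \<longleftrightarrow>
     (\<forall>\<epsilon>>0. \<exists>R>0. \<exists>N>0. \<forall>x\<in>mspace X. \<forall>y\<in>mspace X. R \<le> mdist X x y \<longrightarrow>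
        finite {g \<in> carrier G. mdist X x (\<phi> g x) \<le> \<epsilon> \<and> mdist X y (\<phi> g y) \<le> \<epsilon>} \<and>
        real (card {g \<in> carrier G. mdist X x (\<phi> g x) \<le> \<epsilon> \<and> mdist X y (\<phi> g y) \<le> \<epsilon>}) \<le> N)"

definition non_elementary ::
  "('a, 'b) monoid_scheme \<Rightarrow> 'x metric \<Rightarrow> ('a \<Rightarrow> 'x \<Rightarrow> 'x) \<Rightarrow> bool" where
  "non_elementary G X \<phi> \<longleftrightarrow> infinite (limit_set G X \<phi>) \<or> 2 < card (limit_set G X \<phi>)"

text \<open>HOL cannot quantify over types inside a formula, so the type \<open>'x\<close> containing the points of the
  space is a parameter. In a hypothesis, a type variable \<open>'x\<close> not occurring elsewhere renders the
  existence of an action on a space of any type.\<close>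

definition acylindrically_hyperbolic :: "'x itself \<Rightarrow> ('a, 'b) monoid_scheme \<Rightarrow> bool" where
  "acylindrically_hyperbolic T G \<longleftrightarrow>
     (\<exists>(X :: 'x metric) \<phi>. hyperbolic_space X \<and> isometric_action G X \<phi> \<and>
        acylindrical G X \<phi> \<and> non_elementary G X \<phi>)"


section \<open>The action on the cone\<close>

lemma (in group) foldr_mult_closed:
  "set ws \<subseteq> carrier G \<Longrightarrow> foldr (\<otimes>) ws \<one> \<in> carrier G"
  by (induction ws) auto

lemma (in group) foldr_mult_append:
  "set us \<subseteq> carrier G \<Longrightarrow> set vs \<subseteq> carrier G \<Longrightarrow>
     foldr (\<otimes>) (us @ vs) \<one> = foldr (\<otimes>) us \<one> \<otimes> foldr (\<otimes>) vs \<one>"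
  by (induction us) (auto simp: m_assoc foldr_mult_closed simp del: foldr_append)

lemma (in group) foldr_mult_inv:
  "set ws \<subseteq> carrier G \<Longrightarrow> foldr (\<otimes>) (rev (map (m_inv G) ws)) \<one> = inv (foldr (\<otimes>) ws \<one>)"
proof (induction ws)
  case (Cons a ws)
  have "set (rev (map (m_inv G) ws)) \<subseteq> carrier G" using Cons.prems by auto
  then show ?case using Cons foldr_mult_append[of "rev (map (m_inv G) ws)" "[inv a]"]
    by (simp add: inv_mult_group foldr_mult_closed)
qed simp

locale finitely_generated_group = group G for G (structure) +
  fixes S
  assumes finite_S: "finite S" and S_carrier: "S \<subseteq> carrier G" and generate_S: "generate G S = carrier G"
begin

lemma letters_carrier: "S \<union> m_inv G ` S \<subseteq> carrier G"
  using S_carrier by auto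

lemma ex_word:
  assumes "g \<in> carrier G"
  shows "\<exists>ws. set ws \<subseteq> S \<union> m_inv G ` S \<and> foldr (\<otimes>) ws \<one> = g"
proof -
  have "g \<in> generate G S" using assms generate_S by simp
  then show ?thesis
  proof induction
    case one
    show ?case by (rule exI[of _ "[]"]) simp
  next
    case (incl h)
    then show ?case using S_carrier by (intro exI[of _ "[h]"]) auto
  next
    case (inv h)
    then show ?case using S_carrier by (intro exI[of _ "[inv h]"]) auto
  next
    case (eng h1 h2)
    then obtain us vs where "set us \<subseteq> S \<union> m_inv G ` S" "foldr (\<otimes>) us \<one> = h1"
      "set vs \<subseteq> S \<union> m_inv G ` S" "foldr (\<otimes>) vs \<one> = h2" by auto
    then show ?case using foldr_mult_append[of us vs] letters_carrier
      by (intro exI[of _ "us @ vs"]) (auto simp del: foldr_append)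
  qed
qed

lemma word_length_obtains:
  assumes "g \<in> carrier G"
  obtains ws where "length ws = word_length G S g" "set ws \<subseteq> S \<union> m_inv G ` S" "foldr (\<otimes>) ws \<one> = g"
proof -
  have "\<exists>n ws. length ws = n \<and> set ws \<subseteq> S \<union> m_inv G ` S \<and> foldr (\<otimes>) ws \<one> = g"
    using ex_word[OF assms] by blast
  from LeastI_ex[OF this] show ?thesis using that unfolding word_length_def by blast
qed

lemma word_length_le:
  "set ws \<subseteq> S \<union> m_inv G ` S \<Longrightarrow> foldr (\<otimes>) ws \<one> = g \<Longrightarrow> word_length G S g \<le> length ws"
  unfolding word_length_def by (rule Least_le) blast

lemma word_length_one [simp]: "word_length G S \<one> = 0"
  using word_length_le[of "[]" "\<one>"] by simp

lemma word_length_mult: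
  assumes "g \<in> carrier G" "h \<in> carrier G"
  shows "word_length G S (g \<otimes> h) \<le> word_length G S g + word_length G S h"
proof -
  obtain us where us: "length us = word_length G S g" "set us \<subseteq> S \<union> m_inv G ` S"
    "foldr (\<otimes>) us \<one> = g" using word_length_obtains[OF assms(1)] .
  obtain vs where vs: "length vs = word_length G S h" "set vs \<subseteq> S \<union> m_inv G ` S"
    "foldr (\<otimes>) vs \<one> = h" using word_length_obtains[OF assms(2)] .
  have "foldr (\<otimes>) (us @ vs) \<one> = g \<otimes> h"
    using foldr_mult_append[of us vs] us vs letters_carrier by blast
  moreover have "set (us @ vs) \<subseteq> S \<union> m_inv G ` S" using us vs by auto
  ultimately show ?thesis using word_length_le us(1) vs(1) by (metis length_append)
qed

lemma word_length_inv_le: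
  assumes "g \<in> carrier G"
  shows "word_length G S (inv g) \<le> word_length G S g"
proof -
  obtain us where us: "length us = word_length G S g" "set us \<subseteq> S \<union> m_inv G ` S"
    "foldr (\<otimes>) us \<one> = g" using word_length_obtains[OF assms] .
  have "foldr (\<otimes>) (rev (map (m_inv G) us)) \<one> = inv g"
    using foldr_mult_inv[of us] us letters_carrier by blast
  moreover have "set (rev (map (m_inv G) us)) \<subseteq> S \<union> m_inv G ` S"
    using us(2) S_carrier by (auto simp: subset_iff)
  ultimately show ?thesis using word_length_le us(1) by (metis length_map length_rev)
qed

lemma word_length_inv [simp]: "g \<in> carrier G \<Longrightarrow> word_length G S (inv g) = word_length G S g"
  by (metis inv_closed inv_inv le_antisym word_length_inv_le)

lemma word_dist_nonneg [simp]: "0 \<le> word_dist G S x y"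
  by (simp add: word_dist_def)

lemma word_dist_self [simp]: "x \<in> carrier G \<Longrightarrow> word_dist G S x x = 0"
  by (simp add: word_dist_def)

lemma word_dist_commute: "x \<in> carrier G \<Longrightarrow> y \<in> carrier G \<Longrightarrow> word_dist G S x y = word_dist G S y x"
  using word_length_inv[of "inv x \<otimes> y"] by (simp add: word_dist_def inv_mult_group)

lemma word_dist_triangle:
  assumes "x \<in> carrier G" "y \<in> carrier G" "z \<in> carrier G"
  shows "word_dist G S x z \<le> word_dist G S x y + word_dist G S y z"
proof -
  have "inv x \<otimes> z = (inv x \<otimes> y) \<otimes> (inv y \<otimes> z)"
    using assms by (metis inv_closed inv_solve_left m_assoc m_closed)
  then show ?thesis
    using word_length_mult[of "inv x \<otimes> y" "inv y \<otimes> z"] assms by (simp add: word_dist_def)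
qed

lemma word_dist_mult_left:
  assumes "g \<in> carrier G" "x \<in> carrier G" "y \<in> carrier G"
  shows "word_dist G S (g \<otimes> x) (g \<otimes> y) = word_dist G S x y"
proof -
  have "inv (g \<otimes> x) \<otimes> (g \<otimes> y) = inv x \<otimes> y"
    using assms by (simp add: inv_mult_group m_assoc inv_solve_left')
  then show ?thesis by (simp add: word_dist_def)
qed

lemma admissible_carrier: "x \<in> admissible G S d \<Longrightarrow> x n \<in> carrier G"
  by (simp add: admissible_def)

lemma admissible_translate:
  assumes d: "scaling_sequence d" and g: "g \<in> carrier G" and x: "x \<in> admissible G S d"
  shows "(\<lambda>n. g \<otimes> x n) \<in> admissible G S d"
proof -
  obtain C where C: "\<And>n. real (word_length G S (x n)) / d n \<le> C"
    using x by (auto simp: admissible_def)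
  have "real (word_length G S (g \<otimes> x n)) / d n \<le> real (word_length G S g) / d 0 + C" for n
  proof -
    have dn: "0 < d 0" "d 0 \<le> d n" using d by (auto simp: scaling_sequence_def incseq_def)
    have "real (word_length G S (g \<otimes> x n)) / d n
        \<le> (real (word_length G S g) + real (word_length G S (x n))) / d n"
      using dn word_length_mult[OF g admissible_carrier[OF x, of n]]
      by (intro divide_right_mono) linarith+
    also have "\<dots> = real (word_length G S g) / d n + real (word_length G S (x n)) / d n"
      by (simp add: add_divide_distrib)
    also have "\<dots> \<le> real (word_length G S g) / d 0 + C"
      using dn C by (intro add_mono divide_left_mono) auto
    finally show ?thesis .
  qed
  then show ?thesis using g admissible_carrier[OF x] unfolding admissible_def by blast
qed

lemma equiv_cone_rel:
  assumes d: "scaling_sequence d"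
  shows "equiv (admissible G S d) (cone_rel G S \<omega> d)"
proof (rule equivI)
  show "cone_rel G S \<omega> d \<subseteq> admissible G S d \<times> admissible G S d"
    by (auto simp: cone_rel_def)
  show "refl_on (admissible G S d) (cone_rel G S \<omega> d)"
    by (auto simp: refl_on_def cone_rel_def admissible_carrier)
  show "sym (cone_rel G S \<omega> d)"
    by (auto simp: sym_def cone_rel_def admissible_carrier word_dist_commute)
  show "trans (cone_rel G S \<omega> d)"
  proof (rule transI)
    fix x y z assume "(x, y) \<in> cone_rel G S \<omega> d" "(y, z) \<in> cone_rel G S \<omega> d"
    then have xyz: "x \<in> admissible G S d" "y \<in> admissible G S d" "z \<in> admissible G S d"
      and lim: "((\<lambda>n. word_dist G S (x n) (y n) / d n + word_dist G S (y n) (z n) / d n) \<longlongrightarrow> 0) \<omega>"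
      by (auto simp: cone_rel_def intro: tendsto_add_zero)
    have dpos: "0 < d n" for n using d by (simp add: scaling_sequence_def)
    have "((\<lambda>n. word_dist G S (x n) (z n) / d n) \<longlongrightarrow> 0) \<omega>"
    proof (rule tendsto_sandwich[OF _ _ tendsto_const lim])
      show "\<forall>\<^sub>F n in \<omega>. 0 \<le> word_dist G S (x n) (z n) / d n"
        using dpos by (intro always_eventually allI) (simp add: less_imp_le)
      show "\<forall>\<^sub>F n in \<omega>. word_dist G S (x n) (z n) / d n
          \<le> word_dist G S (x n) (y n) / d n + word_dist G S (y n) (z n) / d n"
      proof (intro always_eventually allI)
        fix n
        have "word_dist G S (x n) (z n) / d n
            \<le> (word_dist G S (x n) (y n) + word_dist G S (y n) (z n)) / d n"
          using word_dist_triangle xyz[THEN admissible_carrier] dpos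
          by (intro divide_right_mono) (auto simp: less_imp_le)
        then show "word_dist G S (x n) (z n) / d n
            \<le> word_dist G S (x n) (y n) / d n + word_dist G S (y n) (z n) / d n"
          by (simp add: add_divide_distrib)
      qed
    qed
    with xyz show "(x, z) \<in> cone_rel G S \<omega> d" by (simp add: cone_rel_def)
  qed
qed

lemma cone_action_class:
  assumes d: "scaling_sequence d" and g: "g \<in> carrier G" and x: "x \<in> admissible G S d"
  shows "cone_action G S \<omega> d g (cone_rel G S \<omega> d `` {x}) = cone_rel G S \<omega> d `` {\<lambda>n. g \<otimes> x n}"
proof -
  let ?E = "cone_rel G S \<omega> d"
  note E = equiv_cone_rel[OF d, of \<omega>]
  have "?E `` {x} \<in> asymptotic_cone G S \<omega> d" unfolding asymptotic_cone_def using x by (rule quotientI)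
  moreover have "(\<Union>y\<in>?E `` {x}. ?E `` {\<lambda>n. g \<otimes> y n}) = ?E `` {\<lambda>n. g \<otimes> x n}"
  proof -
    have "?E `` {\<lambda>n. g \<otimes> y n} = ?E `` {\<lambda>n. g \<otimes> x n}" if "y \<in> ?E `` {x}" for y
    proof -
      from that have "(x, y) \<in> ?E" by simp
      then have "(\<lambda>n. g \<otimes> x n, \<lambda>n. g \<otimes> y n) \<in> ?E"
        using admissible_translate[OF d g] g
        by (auto simp: cone_rel_def word_dist_mult_left admissible_carrier)
      then show ?thesis using equiv_class_eq[OF E] by metis
    qed
    moreover have "x \<in> ?E `` {x}" using equiv_class_self[OF E x] .
    ultimately show ?thesis by blast
  qed
  ultimately show ?thesis by (simp add: cone_action_def)
qed

lemma cone_cases: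
  assumes "p \<in> asymptotic_cone G S \<omega> d"
  obtains x where "x \<in> admissible G S d" "p = cone_rel G S \<omega> d `` {x}"
  using assms unfolding asymptotic_cone_def by (rule quotientE)

lemma class_in_cone: "x \<in> admissible G S d \<Longrightarrow> cone_rel G S \<omega> d `` {x} \<in> asymptotic_cone G S \<omega> d"
  unfolding asymptotic_cone_def by (rule quotientI)

lemma cone_action_closed:
  assumes d: "scaling_sequence d" and g: "g \<in> carrier G" and p: "p \<in> asymptotic_cone G S \<omega> d"
  shows "cone_action G S \<omega> d g p \<in> asymptotic_cone G S \<omega> d"
  using p by (rule cone_cases) (simp add: cone_action_class d g class_in_cone admissible_translate)

lemma cone_action_mult:
  assumes d: "scaling_sequence d" and gh: "g \<in> carrier G" "h \<in> carrier G" and p: "p \<in> asymptotic_cone G S \<omega> d"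
  shows "cone_action G S \<omega> d (g \<otimes> h) p = cone_action G S \<omega> d g (cone_action G S \<omega> d h p)"
  using p by (rule cone_cases)
    (simp add: cone_action_class d gh class_in_cone admissible_translate m_assoc admissible_carrier)

lemma cone_action_one:
  assumes d: "scaling_sequence d" and p: "p \<in> asymptotic_cone G S \<omega> d"
  shows "cone_action G S \<omega> d \<one> p = p"
  using p by (rule cone_cases) (simp add: cone_action_class d admissible_carrier)

lemma group_action_cone:
  assumes d: "scaling_sequence d"
  shows "group_action G (asymptotic_cone G S \<omega> d) (cone_action G S \<omega> d)"
proof -
  let ?X = "asymptotic_cone G S \<omega> d" and ?a = "cone_action G S \<omega> d"
  have bij: "?a g \<in> Bij ?X" if g: "g \<in> carrier G" for g
  proof -
    have "bij_betw (?a g) ?X ?X"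
    proof (rule bij_betw_byWitness[where f' = "?a (inv g)"])
      show "\<forall>p\<in>?X. ?a (inv g) (?a g p) = p" "\<forall>p\<in>?X. ?a g (?a (inv g) p) = p"
        using g d by (simp_all add: cone_action_mult[symmetric] cone_action_one)
      show "?a g ` ?X \<subseteq> ?X" "?a (inv g) ` ?X \<subseteq> ?X"
        using g d by (auto simp: cone_action_closed)
    qed
    moreover have "?a g \<in> extensional ?X" by (simp add: cone_action_def)
    ultimately show ?thesis by (simp add: Bij_def)
  qed
  have "?a \<in> hom G (BijGroup ?X)"
  proof (rule homI)
    fix g assume "g \<in> carrier G" then show "?a g \<in> carrier (BijGroup ?X)"
      using bij by (simp add: BijGroup_def)
  next
    fix g h assume gh: "g \<in> carrier G" "h \<in> carrier G"
    have "?a (g \<otimes> h) = compose ?X (?a g) (?a h)"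
    proof (rule extensionalityI[of _ ?X])
      show "?a (g \<otimes> h) \<in> extensional ?X" by (simp add: cone_action_def)
    qed (simp_all add: compose_eq cone_action_mult d gh)
    then show "?a (g \<otimes> h) = ?a g \<otimes>\<^bsub>BijGroup ?X\<^esub> ?a h"
      using bij gh by (simp add: BijGroup_def)
  qed
  then show ?thesis
    by (simp add: group_action_def group_hom_def group_hom_axioms_def group_BijGroup)
qed

lemma subgroup_cone_kernel:
  assumes "scaling_sequence d"
  shows "subgroup (cone_kernel G S \<omega> d) G"
  unfolding cone_kernel_def
  using group_action.group_hom[OF group_action_cone[OF assms]] by (rule group_hom.subgroup_kernel)

lemma cone_kernel_eq:
  assumes d: "scaling_sequence d"
  shows "cone_kernel G S \<omega> d =
    {g \<in> carrier G. \<forall>x\<in>admissible G S d.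
       ((\<lambda>n. real (word_length G S (inv (x n) \<otimes> g \<otimes> x n)) / d n) \<longlongrightarrow> 0) \<omega>}"
proof -
  let ?X = "asymptotic_cone G S \<omega> d" and ?a = "cone_action G S \<omega> d" and ?E = "cone_rel G S \<omega> d"
  have "?a g = \<one>\<^bsub>BijGroup ?X\<^esub> \<longleftrightarrow> (\<forall>x\<in>admissible G S d.
       ((\<lambda>n. real (word_length G S (inv (x n) \<otimes> g \<otimes> x n)) / d n) \<longlongrightarrow> 0) \<omega>)"
    if g: "g \<in> carrier G" for g
  proof -
    have "?a g = \<one>\<^bsub>BijGroup ?X\<^esub> \<longleftrightarrow> (\<forall>p\<in>?X. ?a g p = p)"
      by (auto simp: BijGroup_def fun_eq_iff cone_action_def)
    also have "\<dots> \<longleftrightarrow> (\<forall>x\<in>admissible G S d. ?E `` {\<lambda>n. g \<otimes> x n} = ?E `` {x})"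
    proof
      assume "\<forall>p\<in>?X. ?a g p = p"
      then show "\<forall>x\<in>admissible G S d. ?E `` {\<lambda>n. g \<otimes> x n} = ?E `` {x}"
        using cone_action_class[OF d g] class_in_cone by metis
    next
      assume "\<forall>x\<in>admissible G S d. ?E `` {\<lambda>n. g \<otimes> x n} = ?E `` {x}"
      then show "\<forall>p\<in>?X. ?a g p = p"
        using cone_action_class[OF d g] by (metis cone_cases)
    qed
    also have "\<dots> \<longleftrightarrow> (\<forall>x\<in>admissible G S d. (x, \<lambda>n. g \<otimes> x n) \<in> ?E)"
      using eq_equiv_class_iff[OF equiv_cone_rel[OF d]] admissible_translate[OF d g] by metis
    also have "\<dots> \<longleftrightarrow> (\<forall>x\<in>admissible G S d.
       ((\<lambda>n. real (word_length G S (inv (x n) \<otimes> g \<otimes> x n)) / d n) \<longlongrightarrow> 0) \<omega>)"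
      using admissible_translate[OF d g] g
      by (intro ball_cong refl) (simp add: cone_rel_def word_dist_def m_assoc admissible_carrier)
    finally show ?thesis .
  qed
  then show ?thesis unfolding cone_kernel_def kernel_def by blast
qed

end

end

theory Submission
  imports Defs
begin

text \<open>The kernel consists of the elements with finite conjugacy class. If the conjugacy class of \<open>g\<close>
  is finite, the word lengths of the conjugates are bounded, hence negligible against \<open>d n\<close>.
  Conversely, let \<open>L a\<close> be the distance from a base point to its image under \<open>a\<close>; it is bounded by a
  multiple of the word length and satisfies the four-point condition on \<open>G\<close>. Three limit points
  yield a loxodromic element \<open>t\<close>, and then, for every \<open>k\<close>, three elements of the form \<open>v\<close> times
  \<open>t\<close> to the power \<open>k\<close> or \<open>-k\<close>, with \<open>v\<close> in a fixed finite set, pointing in pairwise different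
  directions. If some conjugate of \<open>g\<close> has large \<open>L\<close>, then conjugating it further by one of these
  three elements makes \<open>L\<close>, and so the word length, grow linearly in \<open>k\<close>; with \<open>k\<close> close to
  \<open>d n\<close> this shows that \<open>g\<close> acts nontrivially on the cone. Otherwise all conjugates of \<open>g\<close> have
  bounded \<open>L\<close>, so every conjugate moves all points of the orbit by a bounded amount, and
  acylindricity leaves only finitely many conjugates.\<close>

section \<open>Hyperbolic length functions on groups\<close>

text \<open>\<open>L a\<close> models the distance from a base point to its image under
  \<open>a\<close>, and \<open>four_point\<close> is the four-point inequality for the orbit seen
  from there. Working with \<open>L\<close> alone keeps the space out of the argument.\<close>

locale hyperbolic_length = group G for G (structure) +
  fixes L :: "'a \<Rightarrow> real" and \<delta> :: real
  assumes L_one: "L \<one> = 0"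
    and L_inv [simp]: "a \<in> carrier G \<Longrightarrow> L (inv a) = L a"
    and L_mult: "a \<in> carrier G \<Longrightarrow> b \<in> carrier G \<Longrightarrow> L (a \<otimes> b) \<le> L a + L b"
    and delta_nonneg: "0 \<le> \<delta>"
    and four_point: "a \<in> carrier G \<Longrightarrow> b \<in> carrier G \<Longrightarrow> c \<in> carrier G \<Longrightarrow>
      min ((L a + L b - L (inv a \<otimes> b)) / 2) ((L b + L c - L (inv b \<otimes> c)) / 2)
        \<le> (L a + L c - L (inv a \<otimes> c)) / 2 + \<delta>"
begin

text \<open>The Gromov product of the orbit points of \<open>a\<close> and \<open>b\<close>, based
  at the base point. A large value means that \<open>a\<close> and \<open>b\<close> point in nearly
  the same direction.\<close>

definition gp :: "'a \<Rightarrow> 'a \<Rightarrow> real" where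
  "gp a b = (L a + L b - L (inv a \<otimes> b)) / 2"

lemma gp_hyperbolic:
  "a \<in> carrier G \<Longrightarrow> b \<in> carrier G \<Longrightarrow> c \<in> carrier G \<Longrightarrow> min (gp a b) (gp b c) \<le> gp a c + \<delta>"
  using four_point by (simp add: gp_def)

lemma L_nonneg: "a \<in> carrier G \<Longrightarrow> 0 \<le> L a"
  using L_mult[of a "inv a"] L_one by simp

lemma gp_commute:
  assumes "a \<in> carrier G" "b \<in> carrier G"
  shows "gp a b = gp b a"
  using assms L_inv[of "inv a \<otimes> b"] by (simp add: gp_def inv_mult_group)

lemma gp_nonneg: "a \<in> carrier G \<Longrightarrow> b \<in> carrier G \<Longrightarrow> 0 \<le> gp a b"
  using L_mult[of "inv a" b] by (simp add: gp_def)

lemma L_mult_eq: "a \<in> carrier G \<Longrightarrow> b \<in> carrier G \<Longrightarrow> L (a \<otimes> b) = L a + L b - 2 * gp (inv a) b"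
  by (simp add: gp_def field_simps)

text \<open>In the triangle formed by the base point and its images under \<open>a\<close> and
  \<open>a \<otimes> b\<close>, the Gromov products at the first two vertices add up to the side
  \<open>L a\<close>. So if little cancels in \<open>a \<otimes> b\<close> and \<open>L a\<close> is
  large, then \<open>a \<otimes> b\<close> points in the direction of \<open>a\<close>.\<close>

lemma gp_mult_right:
  assumes "a \<in> carrier G" "b \<in> carrier G"
  shows "gp a (a \<otimes> b) = L a - gp (inv a) b"
proof -
  have "inv a \<otimes> (a \<otimes> b) = b"
    using assms by (metis inv_closed l_inv l_one m_assoc)
  then show ?thesis using assms by (simp add: gp_def field_simps)
qed

section \<open>Loxodromic elements\<close>

lemma gp_hyperbolic3:
  assumes "a \<in> carrier G" "b \<in> carrier G" "c \<in> carrier G" "e \<in> carrier G"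
  shows "min (gp a b) (min (gp b c) (gp c e)) \<le> gp a e + 2 * \<delta>"
  using gp_hyperbolic[of a b e] gp_hyperbolic[of b c e] delta_nonneg assms
  by (auto simp: min_def split: if_splits)

text \<open>The two claims feed one induction. Since \<open>t\<close> and \<open>inv t\<close>
  diverge early, the next power stays in the direction of \<open>t\<close>, hence away from
  \<open>inv t\<close>; each further factor then loses only a bounded amount of length.\<close>

lemma loxodromic_pow:
  assumes t: "t \<in> carrier G" and lox: "2 * gp t (inv t) + 2 * \<delta> < L t"
  shows "gp (inv t) (t [^] Suc k) \<le> gp t (inv t) + \<delta> \<and>
    real (Suc k) * (L t - 2 * gp t (inv t) - 2 * \<delta>) \<le> L (t [^] Suc k)"
proof (induction k)
  case 0
  show ?case using t delta_nonneg gp_commute[of t "inv t"] gp_nonneg[of t "inv t"] by simp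
next
  case (Suc k)
  let ?s = "t [^] Suc k"
  have s: "?s \<in> carrier G" using t by simp
  have eq: "t [^] Suc (Suc k) = t \<otimes> ?s" using nat_pow_Suc2[OF t, of "Suc k"] .
  have "min (gp (inv t) (t \<otimes> ?s)) (gp (t \<otimes> ?s) t) \<le> gp (inv t) t + \<delta>"
    using t s by (intro gp_hyperbolic) auto
  moreover have "gp (t \<otimes> ?s) t = L t - gp (inv t) ?s"
    using gp_commute[of t "t \<otimes> ?s"] gp_mult_right[of t ?s] t s by simp
  moreover have "gp (inv t) t = gp t (inv t)" using gp_commute t by simp
  ultimately have "gp (inv t) (t \<otimes> ?s) \<le> gp t (inv t) + \<delta>"
    using Suc lox by (auto simp: min_def split: if_splits)
  moreover have "real (Suc (Suc k)) * (L t - 2 * gp t (inv t) - 2 * \<delta>)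
      = real (Suc k) * (L t - 2 * gp t (inv t) - 2 * \<delta>) + (L t - 2 * gp t (inv t) - 2 * \<delta>)"
    by (simp add: algebra_simps)
  moreover have "L (t \<otimes> ?s) = L t + L ?s - 2 * gp (inv t) ?s" using L_mult_eq t s by simp
  ultimately show ?case using Suc unfolding eq by linarith
qed

text \<open>Positive powers point in the direction of \<open>t\<close>, negative ones in that of
  \<open>inv t\<close>. In the chain \<open>t\<close>, power, inverse power, \<open>inv t\<close>
  the outer products are therefore large, so the middle one must be small, uniformly in
  \<open>k\<close>.\<close>

lemma loxodromic_gp_pow_inv_pow:
  assumes t: "t \<in> carrier G" and lox: "2 * gp t (inv t) + 3 * \<delta> < L t"
  shows "gp (t [^] Suc k) (inv (t [^] Suc k)) \<le> gp t (inv t) + 2 * \<delta>"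
proof -
  \<comment> \<open>Stated for arbitrary \<open>s\<close> because it is applied to both
    \<open>t\<close> and \<open>inv t\<close>.\<close>
  have forward: "L s - gp s (inv s) - \<delta> \<le> gp s (s [^] Suc k)"
    if s: "s \<in> carrier G" and "2 * gp s (inv s) + 3 * \<delta> < L s" for s
  proof (cases k)
    case 0
    have "gp s s = L s" using s by (simp add: gp_def L_one)
    then show ?thesis using s 0 delta_nonneg gp_nonneg[of s "inv s"] by simp
  next
    case (Suc j)
    have "gp (inv s) (s [^] Suc j) \<le> gp s (inv s) + \<delta>"
      using loxodromic_pow[OF s, of j] that delta_nonneg by simp
    then show ?thesis
      using gp_mult_right[of s "s [^] Suc j"] s nat_pow_Suc2[OF s, of "Suc j"] Suc by simp
  qed
  have "gp (inv t) (inv (inv t)) = gp t (inv t)" using t gp_commute[of t "inv t"] by simp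
  then have "L t - gp t (inv t) - \<delta> \<le> gp (inv t) (inv (t [^] Suc k))"
    using forward[of "inv t"] t lox nat_pow_inv[OF t, of "Suc k"] by simp
  moreover have "L t - gp t (inv t) - \<delta> \<le> gp t (t [^] Suc k)" using forward t lox .
  moreover have "min (gp t (t [^] Suc k)) (min (gp (t [^] Suc k) (inv (t [^] Suc k)))
      (gp (inv (t [^] Suc k)) (inv t))) \<le> gp t (inv t) + 2 * \<delta>"
    using t by (intro gp_hyperbolic3) auto
  moreover have "gp (inv (t [^] Suc k)) (inv t) = gp (inv t) (inv (t [^] Suc k))"
    using t by (intro gp_commute) auto
  ultimately show ?thesis using lox by (auto simp: min_def split: if_splits)
qed

text \<open>If neither \<open>x\<close> nor \<open>y\<close> is loxodromic, then each points in the same direction as its inverse,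
  and there is no cancellation in the powers of \<open>x \<otimes> y\<close>.\<close>

lemma ex_loxodromic:
  assumes x: "x \<in> carrier G" and y: "y \<in> carrier G" and xy: "gp x y \<le> C"
    and long: "2 * C + 6 * \<delta> < L x" "2 * C + 6 * \<delta> < L y"
  shows "\<exists>t\<in>carrier G. 2 * gp t (inv t) + 3 * \<delta> < L t"
proof -
  consider "gp x (inv x) \<le> C + \<delta>" | "gp y (inv y) \<le> C + \<delta>"
    | "C + \<delta> < gp x (inv x)" "C + \<delta> < gp y (inv y)" by linarith
  then show ?thesis
  proof cases
    case 1
    then show ?thesis using x long delta_nonneg by (intro bexI[of _ x]) auto
  next
    case 2
    then show ?thesis using y long delta_nonneg by (intro bexI[of _ y]) auto
  next
    case 3
    define t where "t = x \<otimes> y"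
    have t: "t \<in> carrier G" using x y by (simp add: t_def)
    have C: "0 \<le> C" using gp_nonneg[OF x y] xy by simp
    have x'y: "gp (inv x) y \<le> C + \<delta>"
      using gp_hyperbolic[of x "inv x" y] 3 xy x y by (auto simp: min_def split: if_splits)
    have xy': "gp x (inv y) \<le> C + \<delta>"
      using gp_hyperbolic[of x "inv y" y] gp_commute[of y "inv y"] 3 xy x y
      by (auto simp: min_def split: if_splits)
    \<comment> \<open>\<open>t\<close> starts in the direction of \<open>x\<close> and
      \<open>inv t\<close> in that of \<open>inv y\<close>. These two directions are separated, so
      \<open>t\<close> and \<open>inv t\<close> are as well.\<close>
    have "gp x t = L x - gp (inv x) y" using gp_mult_right x y by (simp add: t_def)
    moreover have "gp (inv t) (inv y) = L y - gp (inv x) y"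
      using gp_mult_right[of "inv y" "inv x"] x y gp_commute[of "inv t" "inv y"]
        gp_commute[of y "inv x"] t by (simp add: t_def inv_mult_group)
    moreover have "min (gp x t) (min (gp t (inv t)) (gp (inv t) (inv y))) \<le> gp x (inv y) + 2 * \<delta>"
      using x y t by (intro gp_hyperbolic3) auto
    ultimately have "gp t (inv t) \<le> C + 3 * \<delta>"
      using x'y xy' long delta_nonneg C by (auto simp: min_def split: if_splits)
    moreover have "L t = L x + L y - 2 * gp (inv x) y" using L_mult_eq x y by (simp add: t_def)
    ultimately show ?thesis using t x'y long delta_nonneg C by (intro bexI[of _ t]) auto
  qed
qed

section \<open>Triples of pairwise separated directions\<close>

definition spread :: "real \<Rightarrow> 'a set \<Rightarrow> 'a \<Rightarrow> 'a \<Rightarrow> 'a \<Rightarrow> bool" where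
  "spread C A x y z \<longleftrightarrow> x \<in> A \<and> y \<in> A \<and> z \<in> A \<and> gp x y \<le> C \<and> gp y z \<le> C \<and> gp x z \<le> C"

text \<open>By hyperbolicity each of \<open>u\<close> and \<open>v\<close> can be close to at most
  one of three separated directions, so at least one of the three is left.\<close>

lemma spread_two_directions:
  assumes xyz: "spread C (carrier G) x y z" and u: "u \<in> carrier G" and v: "v \<in> carrier G"
  shows "\<exists>w\<in>{x, y, z}. gp u w \<le> C + \<delta> \<and> gp v w \<le> C + \<delta>"
proof -
  have *: "gp u a \<le> C + \<delta> \<or> gp u b \<le> C + \<delta>"
    if "u \<in> carrier G" "a \<in> carrier G" "b \<in> carrier G" "gp a b \<le> C" for u a b
    using gp_hyperbolic[of a u b] gp_commute[of u a] that
    by (auto simp: min_def split: if_splits)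
  have "gp u x \<le> C + \<delta> \<or> gp u y \<le> C + \<delta>" "gp u y \<le> C + \<delta> \<or> gp u z \<le> C + \<delta>"
    "gp u x \<le> C + \<delta> \<or> gp u z \<le> C + \<delta>" "gp v x \<le> C + \<delta> \<or> gp v y \<le> C + \<delta>"
    "gp v y \<le> C + \<delta> \<or> gp v z \<le> C + \<delta>" "gp v x \<le> C + \<delta> \<or> gp v z \<le> C + \<delta>"
    using *[of u x y] *[of u y z] *[of u x z] *[of v x y] *[of v y z] *[of v x z] xyz u v
    by (auto simp: spread_def)
  then show ?thesis by blast
qed

text \<open>The triples in the assumption come without control of word length. They are replaced by
  elements built from a single \<open>t\<close> and a finite set, whose word length is at most
  linear in \<open>k\<close> while \<open>L\<close> still grows linearly.\<close>

lemma ex_spread_powers: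
  assumes ex: "\<And>R. \<exists>x y z. spread C (carrier G) x y z \<and> R < L x \<and> R < L y \<and> R < L z"
  shows "\<exists>t\<in>carrier G. \<exists>Y. finite Y \<and> Y \<subseteq> carrier G \<and> (\<exists>c>0. \<exists>B C. \<forall>k. \<exists>x y z.
    spread C (\<Union>v\<in>Y. {v \<otimes> t [^] Suc k, v \<otimes> inv (t [^] Suc k)}) x y z \<and>
    (\<forall>w\<in>{x, y, z}. c * real (Suc k) - B \<le> L w))"
proof -
  obtain x y z where "spread C (carrier G) x y z" "2 * C + 6 * \<delta> < L x" "2 * C + 6 * \<delta> < L y"
    using ex by meson
  then obtain t where t: "t \<in> carrier G" and lox: "2 * gp t (inv t) + 3 * \<delta> < L t"
    using ex_loxodromic[of x y C] unfolding spread_def by blast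
  define e where "e = gp t (inv t) + 2 * \<delta>"
  define c where "c = L t - 2 * gp t (inv t) - 2 * \<delta>"
  have c: "0 < c" using lox delta_nonneg by (simp add: c_def)
  \<comment> \<open>A second triple is needed, since the threshold depends on \<open>t\<close>
    through \<open>e\<close>. It is chosen so that \<open>v \<otimes> s\<close> below keeps the
    direction of \<open>v\<close>.\<close>
  obtain x y z where xyz: "spread C (carrier G) x y z"
    and long: "C + e + 3 * \<delta> < L x" "C + e + 3 * \<delta> < L y" "C + e + 3 * \<delta> < L z"
    using ex by meson
  have xyz_carrier: "x \<in> carrier G" "y \<in> carrier G" "z \<in> carrier G"
    using xyz by (auto simp: spread_def)
  \<comment> \<open>The choice of \<open>v\<close> below depends on \<open>k\<close>;
    \<open>B\<close> covers all three candidates at once.\<close>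
  define B where "B = L x + L y + L z"
  define C' where "C' = max e (C + 2 * \<delta>)"
  let ?Y = "{\<one>, x, y, z}"
  have "\<exists>a b w. spread C' (\<Union>v\<in>?Y. {v \<otimes> t [^] Suc k, v \<otimes> inv (t [^] Suc k)}) a b w \<and>
    (\<forall>w\<in>{a, b, w}. c * real (Suc k) - B \<le> L w)" for k
  proof -
    define p where "p = t [^] Suc k"
    have p: "p \<in> carrier G" using t by (simp add: p_def)
    have Lp: "c * real (Suc k) \<le> L p"
      using loxodromic_pow[OF t, of k] lox delta_nonneg by (simp add: p_def c_def mult.commute)
    have pp: "gp p (inv p) \<le> e"
      using loxodromic_gp_pow_inv_pow[OF t lox] by (simp add: p_def e_def)
    obtain v where v: "v \<in> {x, y, z}" and pv: "gp p v \<le> C + \<delta>" "gp (inv p) v \<le> C + \<delta>"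
      using spread_two_directions[OF xyz p, of "inv p"] p by auto
    have vc: "v \<in> carrier G" using v xyz_carrier by auto
    \<comment> \<open>\<open>p\<close> and \<open>inv p\<close> are separated, so
      \<open>inv v\<close> is away from one of them; that sign of the exponent leaves little
      cancellation in \<open>v \<otimes> s\<close>.\<close>
    have "\<exists>s\<in>{p, inv p}. gp (inv v) s \<le> e + \<delta>"
      using gp_hyperbolic[of p "inv v" "inv p"] gp_commute[of p "inv v"] vc p pp
      by (auto simp: min_def split: if_splits)
    then obtain s where s: "s \<in> {p, inv p}" and vs: "gp (inv v) s \<le> e + \<delta>" ..
    have sc: "s \<in> carrier G" and Ls: "L s = L p" using s p by auto
    have far: "C + 2 * \<delta> < gp v (v \<otimes> s)"
      using gp_mult_right[OF vc sc] vs long v by auto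
    have sep: "gp q (v \<otimes> s) \<le> C'" if q: "q \<in> {p, inv p}" for q
    proof -
      have qc: "q \<in> carrier G" and "gp q v \<le> C + \<delta>" using q p pv by auto
      then show ?thesis
        using gp_hyperbolic[of q "v \<otimes> s" v] gp_commute[of v "v \<otimes> s"] vc sc far
        by (auto simp: C'_def min_def split: if_splits)
    qed
    have "L s \<le> L (v \<otimes> s) + L v"
      using L_mult[of "inv v" "v \<otimes> s"] vc sc by (simp add: m_assoc[symmetric])
    moreover have "L v \<le> B" "0 \<le> B"
      using v L_nonneg xyz_carrier by (auto simp: B_def)
    ultimately have "\<forall>w\<in>{p, inv p, v \<otimes> s}. c * real (Suc k) - B \<le> L w"
      using Lp Ls p by auto
    moreover have "p = \<one> \<otimes> p" "inv p = \<one> \<otimes> inv p" using p by auto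
    then have "spread C' (\<Union>v\<in>?Y. {v \<otimes> p, v \<otimes> inv p}) p (inv p) (v \<otimes> s)"
      using pp sep v s unfolding spread_def C'_def by auto
    ultimately show ?thesis unfolding p_def by blast
  qed
  moreover have "finite ?Y" "?Y \<subseteq> carrier G" using xyz_carrier by auto
  ultimately show ?thesis using t c by blast
qed

text \<open>Two of the three elements are not in the direction of \<open>g\<close> and two are not in the direction
  of \<open>inv g\<close>; for an element \<open>w\<close> with both properties, \<open>g \<otimes> w\<close> points in the direction of \<open>g\<close>,
  away from \<open>w\<close>.\<close>

lemma spread_conjugate_long:
  assumes xyz: "spread C (carrier G) x y z" and g: "g \<in> carrier G" and long: "2 * C + 3 * \<delta> < L g"
  shows "\<exists>w\<in>{x, y, z}. L w - 2 * C - 4 * \<delta> \<le> L (inv w \<otimes> g \<otimes> w)"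
proof -
  obtain w where w: "w \<in> {x, y, z}" and gw: "gp g w \<le> C + \<delta>" "gp (inv g) w \<le> C + \<delta>"
    using spread_two_directions[OF xyz g, of "inv g"] g by auto
  have wc: "w \<in> carrier G" using w xyz by (auto simp: spread_def)
  have "C + 2 * \<delta> < gp g (g \<otimes> w)" using gp_mult_right[OF g wc] gw long by simp
  then have "gp (g \<otimes> w) w \<le> C + 2 * \<delta>"
    using gp_hyperbolic[of g "g \<otimes> w" w] g wc gw by (auto simp: min_def split: if_splits)
  moreover have "gp (g \<otimes> w) w = (L w + L (g \<otimes> w) - L (inv w \<otimes> g \<otimes> w)) / 2"
    using gp_commute[of w "g \<otimes> w"] g wc by (simp add: gp_def m_assoc)
  ultimately show ?thesis using L_nonneg[of "g \<otimes> w"] g wc w by (intro bexI[of _ w]) auto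
qed

end

section \<open>Four-point hyperbolicity and the boundary\<close>

lemma geodesic_segment_subset: "geodesic_segment X x y P \<Longrightarrow> P \<subseteq> mspace X"
  by (auto simp: geodesic_segment_def)

lemma geodesic_segment_ends: "geodesic_segment X x y P \<Longrightarrow> x \<in> P \<and> y \<in> P"
  unfolding geodesic_segment_def
  by (metis atLeastAtMost_iff image_eqI mdist_nonneg order_refl)

lemma geodesic_segment_add:
  assumes "geodesic_segment X x y P" "q \<in> P"
  shows "mdist X x q + mdist X q y = mdist X x y"
proof -
  obtain \<gamma> s where \<gamma>: "\<gamma> 0 = x" "\<gamma> (mdist X x y) = y"
    "\<forall>s\<in>{0..mdist X x y}. \<forall>t\<in>{0..mdist X x y}. mdist X (\<gamma> s) (\<gamma> t) = \<bar>s - t\<bar>"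
    and s: "s \<in> {0..mdist X x y}" "q = \<gamma> s"
    using assms unfolding geodesic_segment_def by auto
  have "mdist X (\<gamma> 0) (\<gamma> s) = \<bar>0 - s\<bar>" "mdist X (\<gamma> s) (\<gamma> (mdist X x y)) = \<bar>s - mdist X x y\<bar>"
    using \<gamma>(3) s by auto
  then show ?thesis using \<gamma> s by simp
qed

lemma gromov_product_commute: "gromov_product X p x y = gromov_product X p y x"
  by (simp add: gromov_product_def mdist_commute)

lemma gromov_product_le_dist:
  assumes P: "geodesic_segment X x y P" and q: "q \<in> P" and p: "p \<in> mspace X"
  shows "gromov_product X p x y \<le> mdist X p q"
proof -
  have M: "x \<in> mspace X" "y \<in> mspace X" "q \<in> mspace X"
    using geodesic_segment_subset[OF P] geodesic_segment_ends[OF P] q by auto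
  show ?thesis
    using geodesic_segment_add[OF P q] mdist_triangle[OF M(1) M(3) p] mdist_triangle[OF M(2) M(3) p]
    by (simp add: gromov_product_def mdist_commute)
qed

text \<open>Moving along \<open>P\<close>, one passes from the neighbourhood of one other side to that of the other
  side; a point at the transition is close to both.\<close>

lemma ex_dist_le_gromov_product:
  assumes X: "geodesic_space X" "thin_triangles X \<delta>" and \<delta>: "0 \<le> \<delta>"
    and P: "geodesic_segment X x y P" and p: "p \<in> mspace X"
  shows "\<exists>q\<in>P. mdist X p q \<le> gromov_product X p x y + 2 * \<delta> + 1"
proof -
  have xy: "x \<in> mspace X" "y \<in> mspace X"
    using geodesic_segment_subset[OF P] geodesic_segment_ends[OF P] by auto
  obtain Q R where Q: "geodesic_segment X y p Q" and R: "geodesic_segment X p x R"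
    using X(1) xy p unfolding geodesic_space_def by meson
  define l where "l = mdist X x y"
  obtain \<gamma> where \<gamma>: "\<gamma> 0 = x" "\<gamma> l = y" "P = \<gamma> ` {0..l}"
    "\<And>s t. s \<in> {0..l} \<Longrightarrow> t \<in> {0..l} \<Longrightarrow> mdist X (\<gamma> s) (\<gamma> t) = \<bar>s - t\<bar>"
    using P unfolding geodesic_segment_def l_def by blast
  have l: "0 \<le> l" by (simp add: l_def)
  have thin: "\<exists>r\<in>Q \<union> R. mdist X (\<gamma> s) r \<le> \<delta>" if "s \<in> {0..l}" for s
    using X(2) xy p P Q R \<gamma>(3) that unfolding thin_triangles_def by blast
  define A where "A = {s \<in> {0..l}. \<exists>r\<in>R. mdist X (\<gamma> s) r \<le> \<delta>}"
  have "mdist X (\<gamma> 0) x = 0" using \<gamma>(1) xy by simp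
  then have A0: "0 \<in> A" using \<gamma>(1) geodesic_segment_ends[OF R] l \<delta> by (force simp: A_def)
  have bdd: "bdd_above A" by (rule bdd_aboveI[of _ l]) (auto simp: A_def)
  have "\<exists>s\<in>A. Sup A - 1 / 2 < s" using A0 bdd by (intro less_cSupD) auto
  then obtain s where s: "s \<in> A" "Sup A - 1 / 2 < s" ..
  have "Sup A \<le> l" using A0 by (intro cSup_least) (auto simp: A_def)
  then have sup: "s \<le> Sup A" "0 \<le> Sup A" "Sup A \<le> l"
    using cSup_upper[OF s(1) bdd] cSup_upper[OF A0 bdd] by simp_all
  have s0: "s \<in> {0..l}" using s(1) by (simp add: A_def)
  \<comment> \<open>Just beyond the supremum a point is no longer close to \<open>R\<close>, so it
    is close to \<open>Q\<close>; if the segment ends first, its endpoint \<open>y\<close> lies on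
    \<open>Q\<close>. The two margins of 1/2 produce the summand 1 in the bound.\<close>
  define s' where "s' = min l (Sup A + 1 / 2)"
  have s': "s' \<in> {0..l}" "\<bar>s - s'\<bar> \<le> 1" using sup s(2) s0 l by (auto simp: s'_def)
  have "\<exists>r\<in>Q. mdist X (\<gamma> s') r \<le> \<delta>"
  proof (cases "l \<le> Sup A + 1 / 2")
    case True
    then have "\<gamma> s' = y" using \<gamma> by (simp add: s'_def)
    moreover have "mdist X y y = 0" using xy by simp
    ultimately show ?thesis using geodesic_segment_ends[OF Q] \<delta> by force
  next
    case False
    then have "Sup A < s'" by (simp add: s'_def)
    then have "s' \<notin> A" using cSup_upper[OF _ bdd] by force
    then show ?thesis using thin[OF s'(1)] s'(1) by (auto simp: A_def)
  qed
  then obtain q2 where q2: "q2 \<in> Q" "mdist X (\<gamma> s') q2 \<le> \<delta>" ..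
  obtain q1 where q1: "q1 \<in> R" "mdist X (\<gamma> s) q1 \<le> \<delta>"
    using s(1) by (auto simp: A_def)
  let ?q = "\<gamma> s"
  have q: "?q \<in> P" using s0 \<gamma>(3) by blast
  have M: "?q \<in> mspace X" "\<gamma> s' \<in> mspace X" "q1 \<in> mspace X" "q2 \<in> mspace X"
    using q q1(1) q2(1) s'(1) \<gamma>(3) P[THEN geodesic_segment_subset] Q[THEN geodesic_segment_subset]
      R[THEN geodesic_segment_subset] by auto
  have qq2: "mdist X ?q q2 \<le> \<delta> + 1"
    using mdist_triangle[OF M(1) M(2) M(4)] \<gamma>(4)[OF s0 s'(1)] s' q2 by linarith
  have "mdist X p q1 + mdist X q1 x = mdist X p x" "mdist X y q2 + mdist X q2 p = mdist X y p"
    "mdist X x ?q + mdist X ?q y = mdist X x y"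
    using geodesic_segment_add P Q R q q1 q2 by metis+
  moreover have "mdist X x ?q \<le> mdist X x q1 + mdist X q1 ?q"
    "mdist X y ?q \<le> mdist X y q2 + mdist X q2 ?q"
    "mdist X p ?q \<le> mdist X p q1 + mdist X q1 ?q" "mdist X p ?q \<le> mdist X p q2 + mdist X q2 ?q"
    using M xy p by (auto intro: mdist_triangle)
  ultimately have "2 * mdist X p ?q \<le> 2 * gromov_product X p x y + 4 * \<delta> + 2"
    using qq2 q1 unfolding gromov_product_def
    by (simp add: mdist_commute[of X x p] mdist_commute[of X q1 x] mdist_commute[of X q1 ?q]
        mdist_commute[of X q2 ?q] mdist_commute[of X ?q y] mdist_commute[of X q2 p] field_simps)
  then show ?thesis using q by (intro bexI[of _ ?q]) auto
qed

text \<open>Gromov's four-point form of hyperbolicity. It mentions no geodesics and so restricts to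
  an orbit.\<close>

definition gromov_hyperbolic :: "'x metric \<Rightarrow> real \<Rightarrow> bool" where
  "gromov_hyperbolic X \<delta> \<longleftrightarrow> (\<forall>p\<in>mspace X. \<forall>x\<in>mspace X. \<forall>y\<in>mspace X. \<forall>z\<in>mspace X.
     min (gromov_product X p x y) (gromov_product X p y z) \<le> gromov_product X p x z + \<delta>)"

lemma gromov_hyperbolicD:
  "gromov_hyperbolic X \<delta> \<Longrightarrow> p \<in> mspace X \<Longrightarrow> x \<in> mspace X \<Longrightarrow> y \<in> mspace X \<Longrightarrow> z \<in> mspace X \<Longrightarrow>
     min (gromov_product X p x y) (gromov_product X p y z) \<le> gromov_product X p x z + \<delta>"
  by (simp add: gromov_hyperbolic_def)

text \<open>Up to a constant, a Gromov product at \<open>p\<close> is the distance from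
  \<open>p\<close> to the opposite side. A point of one side near \<open>p\<close> is
  \<open>\<delta>\<close>-close to another side, whose product is then small too; the constant adds
  this \<open>\<delta>\<close> to \<open>2 * \<delta> + 1\<close>.\<close>

lemma hyperbolic_space_imp_gromov_hyperbolic:
  assumes "hyperbolic_space X"
  shows "\<exists>\<delta>\<ge>0. gromov_hyperbolic X \<delta>"
proof -
  obtain \<delta> where \<delta>: "0 \<le> \<delta>" and X: "geodesic_space X" "thin_triangles X \<delta>"
    using assms by (auto simp: hyperbolic_space_def)
  have "min (gromov_product X p x y) (gromov_product X p y z) \<le> gromov_product X p x z + (3 * \<delta> + 1)"
    if p: "p \<in> mspace X" and M: "x \<in> mspace X" "y \<in> mspace X" "z \<in> mspace X" for p x y z
  proof -
    obtain P Q R where PQR: "geodesic_segment X x z P" "geodesic_segment X z y Q"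
      "geodesic_segment X y x R"
      using X(1) M unfolding geodesic_space_def by meson
    obtain q where q: "q \<in> P" "mdist X p q \<le> gromov_product X p x z + 2 * \<delta> + 1"
      using ex_dist_le_gromov_product[OF X \<delta> PQR(1) p] ..
    obtain r where r: "r \<in> Q \<union> R" "mdist X q r \<le> \<delta>"
      using X(2) M PQR q unfolding thin_triangles_def by meson
    have "q \<in> mspace X" "r \<in> mspace X"
      using q(1) r(1) PQR[THEN geodesic_segment_subset] by auto
    then have "mdist X p r \<le> mdist X p q + mdist X q r" using p mdist_triangle by metis
    moreover have "min (gromov_product X p x y) (gromov_product X p y z) \<le> mdist X p r"
      using r gromov_product_le_dist[OF PQR(2) _ p] gromov_product_le_dist[OF PQR(3) _ p]
        gromov_product_commute[of X p]
      by (metis UnE min.coboundedI1 min.coboundedI2)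
    ultimately show ?thesis using q r by linarith
  qed
  then show ?thesis using \<delta> unfolding gromov_hyperbolic_def
    by (intro exI[of _ "3 * \<delta> + 1"]) auto
qed

section \<open>Sequences converging to boundary points\<close>

lemma gromov_product_dist_right:
  assumes "p \<in> mspace X" "x \<in> mspace X" "y \<in> mspace X" "z \<in> mspace X"
  shows "gromov_product X p x y \<le> gromov_product X p x z + mdist X y z"
proof -
  have "mdist X y p \<le> mdist X y z + mdist X z p" "mdist X x z \<le> mdist X x y + mdist X y z"
    using assms by (auto intro: mdist_triangle)
  then show ?thesis by (simp add: gromov_product_def field_simps)
qed

lemma gromov_product_dist_base:
  assumes "p \<in> mspace X" "q \<in> mspace X" "x \<in> mspace X" "y \<in> mspace X"
  shows "gromov_product X p x y \<le> gromov_product X q x y + mdist X p q"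
proof -
  have "mdist X x p \<le> mdist X x q + mdist X q p" "mdist X y p \<le> mdist X y q + mdist X q p"
    using assms by (auto intro: mdist_triangle)
  then show ?thesis by (simp add: gromov_product_def field_simps mdist_commute[of X q p])
qed

lemma converges_to_infinity_mspace: "converges_to_infinity X u \<Longrightarrow> u n \<in> mspace X"
  by (auto simp: converges_to_infinity_def)

lemma equiv_boundary_rel:
  assumes hyp: "gromov_hyperbolic X \<delta>"
  shows "equiv {u. converges_to_infinity X u} (boundary_rel X)"
proof (rule equivI)
  show "boundary_rel X \<subseteq> {u. converges_to_infinity X u} \<times> {u. converges_to_infinity X u}"
    by (auto simp: boundary_rel_def)
  show "refl_on {u. converges_to_infinity X u} (boundary_rel X)"
    by (auto simp: refl_on_def boundary_rel_def converges_to_infinity_def)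
  show "sym (boundary_rel X)"
  proof (rule symI)
    fix u v assume uv: "(u, v) \<in> boundary_rel X"
    have "\<exists>N. \<forall>i\<ge>N. \<forall>j\<ge>N. K \<le> gromov_product X p (v i) (u j)" if "p \<in> mspace X" for p K
      using uv that gromov_product_commute[of X p] unfolding boundary_rel_def by fastforce
    then show "(v, u) \<in> boundary_rel X" using uv by (simp add: boundary_rel_def)
  qed
  show "trans (boundary_rel X)"
  proof (rule transI)
    fix u v w assume uv: "(u, v) \<in> boundary_rel X" and vw: "(v, w) \<in> boundary_rel X"
    have M: "u i \<in> mspace X" "v i \<in> mspace X" "w i \<in> mspace X" for i
      using uv vw by (auto simp: boundary_rel_def converges_to_infinity_mspace)
    have "\<exists>N. \<forall>i\<ge>N. \<forall>j\<ge>N. K \<le> gromov_product X p (u i) (w j)" if p: "p \<in> mspace X" for p K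
    proof -
      obtain N1 N2 where "\<forall>i\<ge>N1. \<forall>j\<ge>N1. K + \<delta> \<le> gromov_product X p (u i) (v j)"
        "\<forall>i\<ge>N2. \<forall>j\<ge>N2. K + \<delta> \<le> gromov_product X p (v i) (w j)"
        using uv vw p unfolding boundary_rel_def by blast
      then have N: "K + \<delta> \<le> gromov_product X p (u i) (v (max N1 N2))"
        "K + \<delta> \<le> gromov_product X p (v (max N1 N2)) (w i)" if "max N1 N2 \<le> i" for i
        using that by auto
      have "K \<le> gromov_product X p (u i) (w j)" if "max N1 N2 \<le> i" "max N1 N2 \<le> j" for i j
        using gromov_hyperbolicD[OF hyp p M(1)[of i] M(2)[of "max N1 N2"] M(3)[of j]] N that
        by (smt (verit))
      then show ?thesis by blast
    qed
    then show "(u, w) \<in> boundary_rel X" using uv vw by (simp add: boundary_rel_def)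
  qed
qed

text \<open>Inequivalence gives one late pair with small product. Late terms of each sequence have
  large products with one another, so by two four-point steps a single large mixed product would
  make that pair's product large.\<close>

lemma not_boundary_rel_imp_bounded:
  assumes hyp: "gromov_hyperbolic X \<delta>" and p: "p \<in> mspace X"
    and u: "converges_to_infinity X u" and v: "converges_to_infinity X v"
    and uv: "(u, v) \<notin> boundary_rel X"
  shows "\<exists>C N. \<forall>i\<ge>N. \<forall>j\<ge>N. gromov_product X p (u i) (v j) \<le> C"
proof -
  note M = converges_to_infinity_mspace[OF u] converges_to_infinity_mspace[OF v]
  obtain q K where q: "q \<in> mspace X"
    and K: "\<And>N. \<exists>i\<ge>N. \<exists>j\<ge>N. gromov_product X q (u i) (v j) < K"
    using u v uv unfolding boundary_rel_def by (auto simp: not_le)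
  \<comment> \<open>\<open>mdist X p q\<close> pays for the change of base point and the last term
    for the two four-point steps; \<open>\<delta>\<close> may have either sign here.\<close>
  define C where "C = K + mdist X p q + 2 * \<bar>\<delta>\<bar>"
  obtain N1 where N1: "\<forall>i\<ge>N1. \<forall>j\<ge>N1. C \<le> gromov_product X p (u i) (u j)"
    using u p unfolding converges_to_infinity_def by meson
  obtain N2 where N2: "\<forall>i\<ge>N2. \<forall>j\<ge>N2. C \<le> gromov_product X p (v i) (v j)"
    using v p unfolding converges_to_infinity_def by meson
  define N where "N = max N1 N2"
  obtain i0 j0 where ij0: "N \<le> i0" "N \<le> j0" "gromov_product X q (u i0) (v j0) < K"
    using K by blast
  have less: "gromov_product X p (u i0) (v j0) < C - 2 * \<bar>\<delta>\<bar>"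
    using gromov_product_dist_base[OF p q M(1)[of i0] M(2)[of j0]] ij0 by (simp add: C_def)
  have "gromov_product X p (u i) (v j) \<le> C" if "N \<le> i" "N \<le> j" for i j
  proof -
    have "C \<le> gromov_product X p (u i0) (u i)" "C \<le> gromov_product X p (v j) (v j0)"
      using N1 N2 that ij0 by (auto simp: N_def)
    then show ?thesis
      using gromov_hyperbolicD[OF hyp p M(1)[of i0] M(1)[of i] M(2)[of j]]
        gromov_hyperbolicD[OF hyp p M(1)[of i0] M(2)[of j] M(2)[of j0]] less
      by (auto simp: min_def abs_if split: if_splits)
  qed
  then show ?thesis by blast
qed

text \<open>Two orbits of one sequence of isometries stay at bounded distance. This lets every limit
  point be reached by the orbit of one fixed base point.\<close>

lemma gromov_boundary_bounded_perturbation: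
  assumes hyp: "gromov_hyperbolic X \<delta>" and \<xi>: "\<xi> \<in> gromov_boundary X" and u: "u \<in> \<xi>"
    and v: "\<And>n. v n \<in> mspace X" and near: "\<And>n. mdist X (u n) (v n) \<le> D"
  shows "v \<in> \<xi>"
proof -
  note E = equiv_boundary_rel[OF hyp]
  have cu: "converges_to_infinity X u"
    using in_quotient_imp_subset[OF E \<xi>[unfolded gromov_boundary_def]] u by auto
  note uM = converges_to_infinity_mspace[OF cu]
  have uv: "gromov_product X p (u i) (u j) \<le> gromov_product X p (u i) (v j) + D"
    and vv: "gromov_product X p (u i) (u j) \<le> gromov_product X p (v i) (v j) + 2 * D"
    if p: "p \<in> mspace X" for p i j
  proof -
    show *: "gromov_product X p (u i) (u j) \<le> gromov_product X p (u i) (v j) + D"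
      using gromov_product_dist_right[OF p uM uM v, of i j j] near[of j] by linarith
    have "gromov_product X p (u i) (v j) \<le> gromov_product X p (v i) (v j) + D"
      using gromov_product_dist_right[OF p v uM v, of j i i] near[of i]
        gromov_product_commute[of X p "v j"] by simp
    with * show "gromov_product X p (u i) (u j) \<le> gromov_product X p (v i) (v j) + 2 * D"
      by simp
  qed
  have large: "\<exists>N. \<forall>i\<ge>N. \<forall>j\<ge>N. K \<le> gromov_product X p (u i) (u j)" if "p \<in> mspace X" for p K
    using cu that by (simp add: converges_to_infinity_def)
  have "\<exists>N. \<forall>i\<ge>N. \<forall>j\<ge>N. K \<le> gromov_product X p (v i) (v j)" if p: "p \<in> mspace X" for p K
    using large[OF p, of "K + 2 * D"] vv[OF p] by (smt (verit))
  then have cv: "converges_to_infinity X v" using v by (auto simp: converges_to_infinity_def)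
  have "\<exists>N. \<forall>i\<ge>N. \<forall>j\<ge>N. K \<le> gromov_product X p (u i) (v j)" if p: "p \<in> mspace X" for p K
    using large[OF p, of "K + D"] uv[OF p] by (smt (verit))
  then have "(u, v) \<in> boundary_rel X" using cu cv by (simp add: boundary_rel_def)
  then show ?thesis using in_quotient_imp_closed[OF E \<xi>[unfolded gromov_boundary_def] u] by simp
qed


section \<open>Orbit lengths of isometric actions\<close>

locale isometric_orbit = group_action G "mspace X" \<phi> for G (structure) and X :: "'x metric" and \<phi> +
  fixes p :: 'x
  assumes isometric: "g \<in> carrier G \<Longrightarrow> x \<in> mspace X \<Longrightarrow> y \<in> mspace X \<Longrightarrow>
      mdist X (\<phi> g x) (\<phi> g y) = mdist X x y"
    and base: "p \<in> mspace X"
begin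

lemma G_group: "group G"
  using group_hom by (simp add: group_hom_def)

lemma act_closed: "g \<in> carrier G \<Longrightarrow> x \<in> mspace X \<Longrightarrow> \<phi> g x \<in> mspace X"
  using element_image by blast

lemma act_one: "x \<in> mspace X \<Longrightarrow> \<phi> \<one> x = x"
  using id_eq_one by (metis restrict_apply')

lemma dist_act:
  assumes "a \<in> carrier G" "b \<in> carrier G" "x \<in> mspace X"
  shows "mdist X (\<phi> a x) (\<phi> b x) = mdist X x (\<phi> (inv a \<otimes> b) x)"
proof -
  interpret group G by (rule G_group)
  have "\<phi> a (\<phi> (inv a \<otimes> b) x) = \<phi> b x"
    using composition_rule[OF assms(3,1), of "inv a \<otimes> b"] assms by (simp add: m_assoc[symmetric])
  then show ?thesis
    using isometric[of a x "\<phi> (inv a \<otimes> b) x"] assms act_closed[of "inv a \<otimes> b" x] by simp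
qed

lemma gromov_product_orbit:
  assumes "a \<in> carrier G" "b \<in> carrier G"
  shows "gromov_product X p (\<phi> a p) (\<phi> b p)
    = (mdist X p (\<phi> a p) + mdist X p (\<phi> b p) - mdist X p (\<phi> (inv a \<otimes> b) p)) / 2"
  using dist_act[OF assms base] by (simp add: gromov_product_def mdist_commute[of X _ p])

lemma hyperbolic_length_orbit:
  assumes "gromov_hyperbolic X \<delta>" "0 \<le> \<delta>"
  shows "hyperbolic_length G (\<lambda>a. mdist X p (\<phi> a p)) \<delta>"
proof -
  interpret group G by (rule G_group)
  show ?thesis
  proof unfold_locales
    show "mdist X p (\<phi> \<one> p) = 0" using base by (simp add: act_one)
    show "mdist X p (\<phi> (inv a) p) = mdist X p (\<phi> a p)" if "a \<in> carrier G" for a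
      using dist_act[of a \<one> p] that base by (simp add: act_one mdist_commute)
    show "mdist X p (\<phi> (a \<otimes> b) p) \<le> mdist X p (\<phi> a p) + mdist X p (\<phi> b p)"
      if ab: "a \<in> carrier G" "b \<in> carrier G" for a b
    proof -
      have "\<phi> (a \<otimes> b) p = \<phi> a (\<phi> b p)" using composition_rule base ab by simp
      then show ?thesis
        using mdist_triangle[of p X "\<phi> a p" "\<phi> a (\<phi> b p)"] isometric[of a p "\<phi> b p"] base ab
          act_closed by simp
    qed
    show "min ((mdist X p (\<phi> a p) + mdist X p (\<phi> b p) - mdist X p (\<phi> (inv a \<otimes> b) p)) / 2)
        ((mdist X p (\<phi> b p) + mdist X p (\<phi> c p) - mdist X p (\<phi> (inv b \<otimes> c) p)) / 2)
      \<le> (mdist X p (\<phi> a p) + mdist X p (\<phi> c p) - mdist X p (\<phi> (inv a \<otimes> c) p)) / 2 + \<delta>"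
      if "a \<in> carrier G" "b \<in> carrier G" "c \<in> carrier G" for a b c
      using gromov_hyperbolicD[OF assms(1) base, of "\<phi> a p" "\<phi> b p" "\<phi> c p"] that base act_closed
      by (simp add: gromov_product_orbit)
  qed (rule assms)
qed

lemma limit_set_sequence:
  assumes hyp: "gromov_hyperbolic X \<delta>" and \<xi>: "\<xi> \<in> limit_set G X \<phi>"
  shows "\<exists>g. range g \<subseteq> carrier G \<and> (\<lambda>n. \<phi> (g n) p) \<in> \<xi>"
proof -
  obtain q g where q: "q \<in> mspace X" and g: "range g \<subseteq> carrier G" and \<xi>g: "(\<lambda>n. \<phi> (g n) q) \<in> \<xi>"
    and \<xi>b: "\<xi> \<in> gromov_boundary X"
    using \<xi> unfolding limit_set_def by blast
  have "(\<lambda>n. \<phi> (g n) p) \<in> \<xi>"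
    using g q base by (intro gromov_boundary_bounded_perturbation[OF hyp \<xi>b \<xi>g, of _ "mdist X q p"])
      (auto simp: act_closed isometric image_subset_iff)
  with g show ?thesis by blast
qed

text \<open>Take orbit sequences tending to three distinct limit points. Far along them the mixed
  products stay bounded while the distances from \<open>p\<close> exceed any \<open>R\<close>; the
  bound \<open>C\<close> is fixed before \<open>R\<close>.\<close>

lemma limit_points_spread:
  assumes hyp: "gromov_hyperbolic X \<delta>" and ne: "non_elementary G X \<phi>"
  shows "\<exists>C. \<forall>R. \<exists>a\<in>carrier G. \<exists>b\<in>carrier G. \<exists>c\<in>carrier G.
    gromov_product X p (\<phi> a p) (\<phi> b p) \<le> C \<and> gromov_product X p (\<phi> b p) (\<phi> c p) \<le> C \<and>
    gromov_product X p (\<phi> a p) (\<phi> c p) \<le> C \<and>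
    R < mdist X p (\<phi> a p) \<and> R < mdist X p (\<phi> b p) \<and> R < mdist X p (\<phi> c p)"
proof -
  \<comment> \<open>An infinite set has \<open>card\<close> 0, hence the case split along the two
    disjuncts of \<open>non_elementary\<close>.\<close>
  have "\<exists>T \<subseteq> limit_set G X \<phi>. card T = 3"
  proof (cases "finite (limit_set G X \<phi>)")
    case True
    then show ?thesis using ne obtain_subset_with_card_n[of 3 "limit_set G X \<phi>"]
      by (auto simp: non_elementary_def)
  next
    case False
    then show ?thesis using infinite_arbitrarily_large by blast
  qed
  then obtain \<xi> \<eta> \<zeta> where pts: "\<xi> \<in> limit_set G X \<phi>" "\<eta> \<in> limit_set G X \<phi>" "\<zeta> \<in> limit_set G X \<phi>"
    and distinct: "\<xi> \<noteq> \<eta>" "\<eta> \<noteq> \<zeta>" "\<xi> \<noteq> \<zeta>"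
    by (auto simp: card_3_iff)
  obtain g h k where g: "range g \<subseteq> carrier G" "(\<lambda>n. \<phi> (g n) p) \<in> \<xi>"
    and h: "range h \<subseteq> carrier G" "(\<lambda>n. \<phi> (h n) p) \<in> \<eta>"
    and k: "range k \<subseteq> carrier G" "(\<lambda>n. \<phi> (k n) p) \<in> \<zeta>"
    using pts[THEN limit_set_sequence[OF hyp]] by blast
  note E = equiv_boundary_rel[OF hyp]
  have boundary: "\<theta> \<in> {u. converges_to_infinity X u} // boundary_rel X"
    if "\<theta> \<in> limit_set G X \<phi>" for \<theta>
    using that by (simp add: limit_set_def gromov_boundary_def)
  have conv: "converges_to_infinity X u" if "\<theta> \<in> limit_set G X \<phi>" "u \<in> \<theta>" for u \<theta>
    using in_quotient_imp_subset[OF E boundary] that by blast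
  have bounded: "\<exists>C N. \<forall>i\<ge>N. \<forall>j\<ge>N. gromov_product X p (u i) (v j) \<le> C"
    if "\<theta> \<in> limit_set G X \<phi>" "\<theta>' \<in> limit_set G X \<phi>" "u \<in> \<theta>" "v \<in> \<theta>'" "\<theta> \<noteq> \<theta>'" for \<theta> \<theta>' u v
    using quotient_eq_iff[OF E boundary boundary] that conv
    by (intro not_boundary_rel_imp_bounded[OF hyp base]) blast+
  obtain C1 N1 where C1: "\<And>i j. N1 \<le> i \<Longrightarrow> N1 \<le> j \<Longrightarrow> gromov_product X p (\<phi> (g i) p) (\<phi> (h j) p) \<le> C1"
    using bounded[OF pts(1,2) g(2) h(2) distinct(1)] by blast
  obtain C2 N2 where C2: "\<And>i j. N2 \<le> i \<Longrightarrow> N2 \<le> j \<Longrightarrow> gromov_product X p (\<phi> (h i) p) (\<phi> (k j) p) \<le> C2"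
    using bounded[OF pts(2,3) h(2) k(2) distinct(2)] by blast
  obtain C3 N3 where C3: "\<And>i j. N3 \<le> i \<Longrightarrow> N3 \<le> j \<Longrightarrow> gromov_product X p (\<phi> (g i) p) (\<phi> (k j) p) \<le> C3"
    using bounded[OF pts(1,3) g(2) k(2) distinct(3)] by blast
  define C where "C = max C1 (max C2 C3)"
  have far: "\<exists>N. \<forall>i\<ge>N. R < mdist X p (u i)" if \<theta>: "\<theta> \<in> limit_set G X \<phi>" "u \<in> \<theta>" for u \<theta> R
  proof -
    obtain N where N: "\<forall>i\<ge>N. \<forall>j\<ge>N. R + 1 \<le> gromov_product X p (u i) (u j)"
      using conv[OF \<theta>] base unfolding converges_to_infinity_def by meson
    \<comment> \<open>On the diagonal the product is the distance from \<open>p\<close>, so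
      convergence to infinity forces the sequence away from \<open>p\<close>.\<close>
    have *: "gromov_product X p (u i) (u i) = mdist X p (u i)" for i
      using converges_to_infinity_mspace[OF conv[OF \<theta>]]
      by (simp add: gromov_product_def mdist_commute)
    have "R < mdist X p (u i)" if "N \<le> i" for i
      using N that *[of i] by fastforce
    then show ?thesis by blast
  qed
  have "\<exists>a\<in>carrier G. \<exists>b\<in>carrier G. \<exists>c\<in>carrier G.
    gromov_product X p (\<phi> a p) (\<phi> b p) \<le> C \<and> gromov_product X p (\<phi> b p) (\<phi> c p) \<le> C \<and>
    gromov_product X p (\<phi> a p) (\<phi> c p) \<le> C \<and>
    R < mdist X p (\<phi> a p) \<and> R < mdist X p (\<phi> b p) \<and> R < mdist X p (\<phi> c p)" for R
  proof -
    obtain M1 where M1: "\<And>i. M1 \<le> i \<Longrightarrow> R < mdist X p (\<phi> (g i) p)"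
      using far[OF pts(1) g(2)] by blast
    obtain M2 where M2: "\<And>i. M2 \<le> i \<Longrightarrow> R < mdist X p (\<phi> (h i) p)"
      using far[OF pts(2) h(2)] by blast
    obtain M3 where M3: "\<And>i. M3 \<le> i \<Longrightarrow> R < mdist X p (\<phi> (k i) p)"
      using far[OF pts(3) k(2)] by blast
    define n where "n = N1 + N2 + N3 + M1 + M2 + M3"
    have "g n \<in> carrier G" "h n \<in> carrier G" "k n \<in> carrier G" using g h k by auto
    moreover have "gromov_product X p (\<phi> (g n) p) (\<phi> (h n) p) \<le> C"
      "gromov_product X p (\<phi> (h n) p) (\<phi> (k n) p) \<le> C" "gromov_product X p (\<phi> (g n) p) (\<phi> (k n) p) \<le> C"
      using C1[of n n] C2[of n n] C3[of n n] by (auto simp: C_def n_def)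
    moreover have "R < mdist X p (\<phi> (g n) p)" "R < mdist X p (\<phi> (h n) p)" "R < mdist X p (\<phi> (k n) p)"
      using M1 M2 M3 by (auto simp: n_def)
    ultimately show ?thesis by blast
  qed
  then show ?thesis by blast
qed

end

section \<open>The kernel\<close>

lemma scaling_sequence_at_top: "scaling_sequence d \<Longrightarrow> filterlim d at_top sequentially"
  unfolding filterlim_at_top scaling_sequence_def eventually_sequentially
  by (smt (verit) bdd_above.I2 incseq_def)

text \<open>The ultrafilter dichotomy for \<open>{k}\<close> makes the complement of each point
  large, and hence every cofinite set. Ordinary limits thus pass to \<open>\<omega>\<close>.\<close>

lemma nonprincipal_ultrafilter_le_sequentially:
  assumes "nonprincipal_ultrafilter \<omega>"
  shows "\<omega> \<le> sequentially"
proof (rule filter_leI)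
  fix P assume "eventually P sequentially"
  then obtain N where N: "\<And>n. N \<le> n \<Longrightarrow> P n" by (auto simp: eventually_sequentially)
  have "\<forall>\<^sub>F n in \<omega>. n \<noteq> k" for k
    using assms unfolding nonprincipal_ultrafilter_def
    by (elim conjE allE[of _ "{k}"] allE[of _ k]) auto
  then have "\<forall>\<^sub>F n in \<omega>. \<forall>k\<in>{..<N}. n \<noteq> k" by (intro eventually_ball_finite) auto
  then show "eventually P \<omega>" by (rule eventually_mono) (metis N lessThan_iff leI)
qed

section \<open>Word lengths of conjugates and the kernel\<close>

context finitely_generated_group
begin

lemma word_length_pow: "x \<in> carrier G \<Longrightarrow> word_length G S (x [^] (n :: nat)) \<le> n * word_length G S x"
proof (induction n)
  case (Suc n)
  then show ?case using word_length_mult[of "x [^] n" x] by simp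
qed simp

lemma finite_conjugates_imp_cone_kernel:
  assumes \<omega>: "\<omega> \<le> sequentially" and d: "scaling_sequence d" and g: "g \<in> carrier G"
    and fin: "finite ((\<lambda>x. inv x \<otimes> g \<otimes> x) ` carrier G)"
  shows "g \<in> cone_kernel G S \<omega> d"
proof -
  define W where "W = Max (word_length G S ` (\<lambda>x. inv x \<otimes> g \<otimes> x) ` carrier G)"
  have W: "word_length G S (inv x \<otimes> g \<otimes> x) \<le> W" if "x \<in> carrier G" for x
    unfolding W_def using fin that by (intro Max_ge) auto
  have dpos: "0 < d n" for n using d by (simp add: scaling_sequence_def)
  have "((\<lambda>n. real W / d n) \<longlongrightarrow> 0) sequentially"
    using scaling_sequence_at_top[OF d]
    by (intro tendsto_divide_0[OF tendsto_const] filterlim_at_top_imp_at_infinity)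
  then have lim: "((\<lambda>n. real W / d n) \<longlongrightarrow> 0) \<omega>" using \<omega> by (rule tendsto_mono[rotated])
  have "((\<lambda>n. real (word_length G S (inv (x n) \<otimes> g \<otimes> x n)) / d n) \<longlongrightarrow> 0) \<omega>"
    if x: "x \<in> admissible G S d" for x
    by (rule tendsto_sandwich[OF _ _ tendsto_const lim])
      (use dpos W admissible_carrier[OF x] in
        \<open>auto intro!: always_eventually divide_right_mono simp: less_imp_le\<close>)
  then show ?thesis using g by (simp add: cone_kernel_eq[OF d])
qed

text \<open>With \<open>k\<close> chosen close to \<open>d n\<close>, the elements
  \<open>y \<otimes> w\<close> form an admissible sequence by the upper bound. By the lower bound
  the rescaled conjugates stay at least \<open>c / 2\<close> once \<open>d n\<close> exceeds
  \<open>2 * B / c\<close>.\<close>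

lemma linear_conjugates_imp_not_cone_kernel:
  assumes \<omega>: "\<omega> \<le> sequentially" "\<omega> \<noteq> bot" and d: "scaling_sequence d"
    and y: "y \<in> carrier G" and c: "0 < c" and nonneg: "0 \<le> a" "0 \<le> b"
    and growth: "\<And>k. \<exists>w\<in>carrier G. real (word_length G S w) \<le> a * real (Suc k) + b \<and>
      c * real (Suc k) - B \<le> real (word_length G S (inv w \<otimes> (inv y \<otimes> g \<otimes> y) \<otimes> w))"
  shows "g \<notin> cone_kernel G S \<omega> d"
proof
  assume "g \<in> cone_kernel G S \<omega> d"
  then have g: "g \<in> carrier G" and lim: "\<And>x. x \<in> admissible G S d \<Longrightarrow>
      ((\<lambda>n. real (word_length G S (inv (x n) \<otimes> g \<otimes> x n)) / d n) \<longlongrightarrow> 0) \<omega>"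
    by (auto simp: cone_kernel_eq[OF d])
  obtain w where w: "\<And>k. w k \<in> carrier G"
    and short: "\<And>k. real (word_length G S (w k)) \<le> a * real (Suc k) + b"
    and long: "\<And>k. c * real (Suc k) - B
        \<le> real (word_length G S (inv (w k) \<otimes> (inv y \<otimes> g \<otimes> y) \<otimes> w k))"
    using growth by metis
  \<comment> \<open>The floor puts \<open>Suc (k n)\<close> between \<open>d n\<close> and
    \<open>d n + 1\<close>.\<close>
  define k where "k n = nat \<lfloor>d n\<rfloor>" for n
  define x where "x n = y \<otimes> w (k n)" for n
  have d0: "0 < d 0" "d 0 \<le> d n" "0 < d n" for n
    using d by (auto simp: scaling_sequence_def incseq_def)
  have k: "d n \<le> real (Suc (k n))" "real (Suc (k n)) \<le> d n + 1" for n
    using d0(3)[of n] unfolding k_def by linarith+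
  define E where "E = real (word_length G S y) + a + b"
  have "real (word_length G S (x n)) / d n \<le> a + E / d 0" for n
  proof -
    have "real (word_length G S (x n)) \<le> real (word_length G S y) + real (word_length G S (w (k n)))"
      using word_length_mult[OF y w[of "k n"]] by (simp add: x_def)
    also have "\<dots> \<le> real (word_length G S y) + (a * real (Suc (k n)) + b)"
      using short by simp
    also have "a * real (Suc (k n)) \<le> a * (d n + 1)"
      using k nonneg by (intro mult_left_mono) auto
    finally have "real (word_length G S (x n)) \<le> a * d n + E"
      by (simp add: E_def algebra_simps)
    then have "real (word_length G S (x n)) / d n \<le> (a * d n + E) / d n"
      using d0(3)[of n] by (intro divide_right_mono) auto
    also have "\<dots> = a + E / d n" using d0(3)[of n] by (simp add: field_simps)
    also have "E / d n \<le> E / d 0"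
      using d0(1,2) d0(3)[of n] nonneg by (intro divide_left_mono) (auto simp: E_def)
    finally show ?thesis by simp
  qed
  then have "x \<in> admissible G S d" using y w by (auto simp: admissible_def x_def)
  then have "\<forall>\<^sub>F n in \<omega>. real (word_length G S (inv (x n) \<otimes> g \<otimes> x n)) / d n < c / 2"
    using lim c by (intro order_tendstoD(2)) auto
  moreover have "\<forall>\<^sub>F n in \<omega>. 2 * B / c \<le> d n"
    using scaling_sequence_at_top[OF d] \<omega>(1) unfolding filterlim_at_top by (blast intro: filter_leD)
  ultimately have "\<forall>\<^sub>F n in \<omega>. False"
  proof eventually_elim
    case (elim n)
    have "inv (x n) \<otimes> g \<otimes> x n = inv (w (k n)) \<otimes> (inv y \<otimes> g \<otimes> y) \<otimes> w (k n)"
      using y g w[of "k n"] by (simp add: x_def inv_mult_group m_assoc)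
    then have "c * real (Suc (k n)) - B \<le> real (word_length G S (inv (x n) \<otimes> g \<otimes> x n))"
      using long[of "k n"] by simp
    moreover have "c * d n \<le> c * real (Suc (k n))" using k c by (intro mult_left_mono) auto
    moreover have "real (word_length G S (inv (x n) \<otimes> g \<otimes> x n)) < c / 2 * d n"
      using elim(1) d0(3)[of n] by (simp add: divide_less_eq)
    moreover have "2 * B \<le> c * d n" using elim(2) c by (simp add: divide_le_eq mult.commute)
    ultimately show False by (simp add: field_simps)
  qed
  then show False using \<omega>(2) by simp
qed

end

section \<open>Comparing the hyperbolic length with the word length\<close>

locale hyperbolic_word_length = hyperbolic_length G L \<delta> + finitely_generated_group G S
  for G (structure) and L \<delta> S
begin

lemma L_le_word_length: "\<exists>M>0. \<forall>g\<in>carrier G. L g \<le> M * real (word_length G S g)"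
proof -
  \<comment> \<open>The sum dominates \<open>L\<close> on each letter; the 1 keeps \<open>M\<close>
    positive even if \<open>L\<close> vanishes on all letters.\<close>
  define M where "M = 1 + sum L (S \<union> m_inv G ` S)"
  have fin: "finite (S \<union> m_inv G ` S)" using finite_S by simp
  have pos: "0 \<le> L s" if "s \<in> S \<union> m_inv G ` S" for s using that L_nonneg letters_carrier by blast
  have "0 \<le> sum L (S \<union> m_inv G ` S)" using pos by (rule sum_nonneg)
  then have "0 < M" by (simp add: M_def)
  have letter: "L s \<le> M" if "s \<in> S \<union> m_inv G ` S" for s
    using member_le_sum[OF that _ fin, of L] pos by (simp add: M_def)
  have word: "L (foldr (\<otimes>) ws \<one>) \<le> M * real (length ws)" if "set ws \<subseteq> S \<union> m_inv G ` S" for ws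
    using that
  proof (induction ws)
    case (Cons s ws)
    then have "s \<in> carrier G" "foldr (\<otimes>) ws \<one> \<in> carrier G"
      using letters_carrier foldr_mult_closed[of ws] by auto
    then show ?case using Cons letter[of s] L_mult[of s "foldr (\<otimes>) ws \<one>"]
      by (simp add: algebra_simps)
  qed (simp add: L_one)
  have "L g \<le> M * real (word_length G S g)" if "g \<in> carrier G" for g
    using word_length_obtains[OF that] word by metis
  then show ?thesis using \<open>0 < M\<close> by blast
qed

text \<open>A conjugate beyond the bound could be conjugated further by some member of the triples
  of powers so that \<open>L\<close> grows linearly in \<open>k\<close>. Dividing by
  \<open>M\<close> turns this into linear growth of the word length, which the kernel
  excludes.\<close>

lemma cone_kernel_conjugates_bounded:
  assumes ex: "\<And>R. \<exists>x y z. spread C (carrier G) x y z \<and> R < L x \<and> R < L y \<and> R < L z"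
    and \<omega>: "\<omega> \<le> sequentially" "\<omega> \<noteq> bot" and d: "scaling_sequence d"
  shows "\<exists>D. \<forall>g\<in>cone_kernel G S \<omega> d. \<forall>y\<in>carrier G. L (inv y \<otimes> g \<otimes> y) \<le> D"
proof -
  obtain M where M: "0 < M" "\<And>g. g \<in> carrier G \<Longrightarrow> L g \<le> M * real (word_length G S g)"
    using L_le_word_length by blast
  \<comment> \<open>From here on \<open>C\<close> is the separation constant of the triples of
    powers and shadows the one in the assumption.\<close>
  obtain t Y c B C where t: "t \<in> carrier G" and Y: "finite Y" "Y \<subseteq> carrier G" and c: "0 < c"
    and sp: "\<And>k. \<exists>x y z. spread C (\<Union>v\<in>Y. {v \<otimes> t [^] Suc k, v \<otimes> inv (t [^] Suc k)}) x y z \<and>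
      (\<forall>w\<in>{x, y, z}. c * real (Suc k) - B \<le> L w)"
    using ex_spread_powers[OF ex] by blast
  define b where "b = (\<Sum>v\<in>Y. word_length G S v)"
  have short: "word_length G S w \<le> word_length G S t * Suc k + b"
    if w: "w \<in> (\<Union>v\<in>Y. {v \<otimes> t [^] Suc k, v \<otimes> inv (t [^] Suc k)})" for w k
  proof -
    obtain v s where v: "v \<in> Y" and s: "s \<in> {t [^] Suc k, inv (t [^] Suc k)}" and vs: "w = v \<otimes> s"
      using w by blast
    have pow: "t [^] Suc k \<in> carrier G" using t by simp
    then have "s \<in> carrier G" "word_length G S s = word_length G S (t [^] Suc k)"
      using s by auto
    moreover have "word_length G S v \<le> b" unfolding b_def using Y v by (intro member_le_sum) auto
    moreover have "v \<in> carrier G" using v Y by blast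
    ultimately show ?thesis
      using word_length_mult[of v s] word_length_pow[OF t, of "Suc k"] vs by (simp add: mult.commute)
  qed
  have "L (inv y \<otimes> g \<otimes> y) \<le> 2 * C + 3 * \<delta>" if g: "g \<in> cone_kernel G S \<omega> d" and y: "y \<in> carrier G" for g y
  proof (rule ccontr)
    assume "\<not> ?thesis"
    then have far: "2 * C + 3 * \<delta> < L (inv y \<otimes> g \<otimes> y)" by simp
    let ?h = "inv y \<otimes> g \<otimes> y"
    have gc: "g \<in> carrier G" using g by (simp add: cone_kernel_eq[OF d])
    then have h: "?h \<in> carrier G" using y by simp
    have growth: "\<exists>w\<in>carrier G. real (word_length G S w) \<le> real (word_length G S t) * real (Suc k) + real b \<and>
      c / M * real (Suc k) - (B + 2 * C + 4 * \<delta>) / M \<le> real (word_length G S (inv w \<otimes> ?h \<otimes> w))" for k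
    proof -
      let ?A = "\<Union>v\<in>Y. {v \<otimes> t [^] Suc k, v \<otimes> inv (t [^] Suc k)}"
      obtain x1 x2 x3 where x: "spread C ?A x1 x2 x3"
        and large: "\<forall>w\<in>{x1, x2, x3}. c * real (Suc k) - B \<le> L w"
        using sp[of k] by blast
      have A: "?A \<subseteq> carrier G" using Y t by auto
      then have "spread C (carrier G) x1 x2 x3" using x unfolding spread_def by blast
      then obtain w where w: "w \<in> {x1, x2, x3}" "L w - 2 * C - 4 * \<delta> \<le> L (inv w \<otimes> ?h \<otimes> w)"
        using spread_conjugate_long[OF _ h far] by blast
      have wA: "w \<in> ?A" using x w unfolding spread_def by blast
      then have wc: "w \<in> carrier G" using A by blast
      have "c * real (Suc k) - (B + 2 * C + 4 * \<delta>) \<le> M * real (word_length G S (inv w \<otimes> ?h \<otimes> w))"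
        using M(2)[of "inv w \<otimes> ?h \<otimes> w"] wc h w large by fastforce
      then have "(c * real (Suc k) - (B + 2 * C + 4 * \<delta>)) / M \<le> real (word_length G S (inv w \<otimes> ?h \<otimes> w))"
        using M(1) by (simp add: divide_le_eq mult.commute)
      moreover have "real (word_length G S w) \<le> real (word_length G S t) * real (Suc k) + real b"
        using short[OF wA] by (metis of_nat_add of_nat_le_iff of_nat_mult)
      ultimately show ?thesis using wc by (intro bexI[of _ w]) (auto simp: diff_divide_distrib)
    qed
    have "g \<notin> cone_kernel G S \<omega> d"
      by (rule linear_conjugates_imp_not_cone_kernel[OF \<omega> d y _ _ _ growth]) (use c M in auto)
    then show False using g by contradiction
  qed
  then show ?thesis by blast
qed

end

section \<open>Acylindricity and the description of the kernel\<close>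

lemma (in isometric_orbit) bounded_conjugates_imp_finite:
  assumes acyl: "acylindrical G X \<phi>" and unbounded: "\<And>R. \<exists>y\<in>carrier G. R < mdist X p (\<phi> y p)"
    and g: "g \<in> carrier G" and bounded: "\<And>y. y \<in> carrier G \<Longrightarrow> mdist X p (\<phi> (inv y \<otimes> g \<otimes> y) p) \<le> D"
  shows "finite ((\<lambda>x. inv x \<otimes> g \<otimes> x) ` carrier G)"
proof -
  interpret group G by (rule G_group)
  \<comment> \<open>Acylindricity asks for a positive displacement bound, hence the maximum with
    1.\<close>
  have "0 < max D 1" by simp
  then obtain R where R: "\<And>x y. x \<in> mspace X \<Longrightarrow> y \<in> mspace X \<Longrightarrow> R \<le> mdist X x y \<Longrightarrow>
      finite {g \<in> carrier G. mdist X x (\<phi> g x) \<le> max D 1 \<and> mdist X y (\<phi> g y) \<le> max D 1}"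
    using acyl unfolding acylindrical_def by meson
  obtain y where y: "y \<in> carrier G" "R < mdist X p (\<phi> y p)" using unbounded by blast
  have "(\<lambda>x. inv x \<otimes> g \<otimes> x) ` carrier G
      \<subseteq> {g \<in> carrier G. mdist X p (\<phi> g p) \<le> max D 1 \<and> mdist X (\<phi> y p) (\<phi> g (\<phi> y p)) \<le> max D 1}"
  proof (intro image_subsetI CollectI conjI)
    fix x assume x: "x \<in> carrier G"
    let ?h = "inv x \<otimes> g \<otimes> x"
    show h: "?h \<in> carrier G" using x g by simp
    show "mdist X p (\<phi> ?h p) \<le> max D 1" using bounded[OF x] by simp
    \<comment> \<open>The displacement of the second point under \<open>?h\<close> equals that of
      \<open>p\<close> under the conjugate of \<open>g\<close> by \<open>x \<otimes> y\<close>, so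
      the same bound applies.\<close>
    have "\<phi> ?h (\<phi> y p) = \<phi> (?h \<otimes> y) p" using composition_rule[OF base h y(1)] by simp
    then have "mdist X (\<phi> y p) (\<phi> ?h (\<phi> y p)) = mdist X p (\<phi> (inv y \<otimes> (?h \<otimes> y)) p)"
      using dist_act[OF y(1) _ base, of "?h \<otimes> y"] h y(1) by simp
    also have "inv y \<otimes> (?h \<otimes> y) = inv (x \<otimes> y) \<otimes> g \<otimes> (x \<otimes> y)"
      using x y g by (simp add: inv_mult_group m_assoc)
    finally show "mdist X (\<phi> y p) (\<phi> ?h (\<phi> y p)) \<le> max D 1"
      using bounded[of "x \<otimes> y"] x y by simp
  qed
  then show ?thesis using R[OF base act_closed[OF y(1) base] less_imp_le[OF y(2)]]
    by (rule finite_subset)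
qed

text \<open>The right-hand side mentions neither \<open>\<omega>\<close> nor \<open>d\<close>, which
  gives the independence.\<close>

theorem (in finitely_generated_group) cone_kernel_eq_finite_conjugates:
  assumes hyp: "acylindrically_hyperbolic TYPE('x) G"
    and \<omega>: "nonprincipal_ultrafilter \<omega>" and d: "scaling_sequence d"
  shows "cone_kernel G S \<omega> d = {g \<in> carrier G. finite ((\<lambda>x. inv x \<otimes> g \<otimes> x) ` carrier G)}"
proof -
  have \<omega>': "\<omega> \<le> sequentially" "\<omega> \<noteq> bot"
    using nonprincipal_ultrafilter_le_sequentially[OF \<omega>] \<omega>
    by (auto simp: nonprincipal_ultrafilter_def)
  obtain X :: "'x metric" and \<phi> where X: "hyperbolic_space X" and iso: "isometric_action G X \<phi>"
    and acyl: "acylindrical G X \<phi>" and ne: "non_elementary G X \<phi>"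
    using hyp unfolding acylindrically_hyperbolic_def by blast
  obtain \<delta> where \<delta>: "0 \<le> \<delta>" "gromov_hyperbolic X \<delta>"
    using hyperbolic_space_imp_gromov_hyperbolic[OF X] by blast
  \<comment> \<open>A limit point guarantees that the space is nonempty and so provides a base
    point.\<close>
  have "limit_set G X \<phi> \<noteq> {}" using ne by (auto simp: non_elementary_def)
  then obtain p where p: "p \<in> mspace X" by (auto simp: limit_set_def)
  interpret isometric_orbit G X \<phi> p
    using iso p by (simp add: isometric_orbit_def isometric_orbit_axioms_def isometric_action_def)
  interpret hyperbolic_length G "\<lambda>a. mdist X p (\<phi> a p)" \<delta>
    using hyperbolic_length_orbit \<delta> by blast
  interpret hyperbolic_word_length G "\<lambda>a. mdist X p (\<phi> a p)" \<delta> S ..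
  have gp: "gp a b = gromov_product X p (\<phi> a p) (\<phi> b p)" if "a \<in> carrier G" "b \<in> carrier G" for a b
    using gromov_product_orbit that by (simp add: gp_def)
  obtain C where C: "\<And>R. \<exists>x y z. spread C (carrier G) x y z \<and>
      R < mdist X p (\<phi> x p) \<and> R < mdist X p (\<phi> y p) \<and> R < mdist X p (\<phi> z p)"
    using limit_points_spread[OF \<delta>(2) ne] gp unfolding spread_def by metis
  show ?thesis
  proof (intro equalityI subsetI)
    fix g assume g: "g \<in> cone_kernel G S \<omega> d"
    then have gc: "g \<in> carrier G" by (simp add: cone_kernel_eq[OF d])
    obtain D where "\<And>y. y \<in> carrier G \<Longrightarrow> mdist X p (\<phi> (inv y \<otimes> g \<otimes> y) p) \<le> D"
      using cone_kernel_conjugates_bounded[OF C \<omega>' d] g by blast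
    moreover have "\<exists>y\<in>carrier G. R < mdist X p (\<phi> y p)" for R
      using C[of R] unfolding spread_def by blast
    ultimately show "g \<in> {g \<in> carrier G. finite ((\<lambda>x. inv x \<otimes> g \<otimes> x) ` carrier G)}"
      using bounded_conjugates_imp_finite[OF acyl _ gc] gc by blast
  next
    fix g assume "g \<in> {g \<in> carrier G. finite ((\<lambda>x. inv x \<otimes> g \<otimes> x) ` carrier G)}"
    then show "g \<in> cone_kernel G S \<omega> d" using finite_conjugates_imp_cone_kernel[OF \<omega>'(1) d] by blast
  qed
qed

theorem corollary1p3:
  fixes G :: "('a, 'b) monoid_scheme" and S :: "'a set"
    and \<omega> \<omega>' :: "nat filter" and d d' :: "nat \<Rightarrow> real"
  assumes "group G"
    and "finite S" and "S \<subseteq> carrier G" and "generate G S = carrier G"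
    and "acylindrically_hyperbolic TYPE('x) G"
    and "nonprincipal_ultrafilter \<omega>" and "scaling_sequence d"
    and "nonprincipal_ultrafilter \<omega>'" and "scaling_sequence d'"
  shows "cone_kernel G S \<omega> d = cone_kernel G S \<omega>' d'"
proof -
  interpret finitely_generated_group G S
    using assms(1-4) by (simp add: finitely_generated_group_def finitely_generated_group_axioms_def)
  show ?thesis using cone_kernel_eq_finite_conjugates[OF assms(5)] assms(6-9) by simp
qed

end
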